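(* Let $d\ge 2$, let $\mathsf D$ be a Borel probability measure on $\mathbf R^d$ with zero mean and finite second moment, and let $\Sigma_{\mathsf D}=\mathbb E_{\mathsf D}[xx^\top]$. For the problem of finding the top principal component, $$\max_{v\in\mathbb S^{d-1}}\ \mathbb E_{x\sim\mathsf D}\tfrac12\langle v,x\rangle^2,$$ the radius of statistical efficiency is $$\mathrm{RSE}(\mathsf D)=\tfrac1{\sqrt2}\Big(\sqrt{\lambda_1(\Sigma_{\mathsf D})}-\sqrt{\lambda_2(\Sigma_{\mathsf D})}\Big).$$ In particular, if $\mathsf D\in\mathcal P_2^\circ\setminus\mathcal E$, then $$\mathrm{RSE}(\mathsf D)\cdot\mathrm{REG}(\mathsf D)=\frac{1}{\sqrt2\big(\sqrt{\lambda_1(\Sigma_{\mathsf D})}+\sqrt{\lambda_2(\Sigma_{\mathsf D})}\big)}.$$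
   Context: $\mathcal P_2^\circ$ is the set of centered Borel probability measures on $\mathbf R^d$ with finite second moment; $\lambda_1\ge\lambda_2\ge\dots$ are ordered eigenvalues; $\mathbb S^{d-1}$ is the unit sphere. $W_2(\mu,\nu)=\min_{\pi\in\Pi(\mu,\nu)}(\mathbb E_{(x,y)\sim\pi}\|x-y\|_2^2)^{1/2}$ over couplings and $W_2(\mu,\mathcal E)=\inf_{\nu\in\mathcal E}W_2(\mu,\nu)$. Tilt-stability and REG: for a $C^2$ embedded submanifold $\mathcal M$ of a Euclidean space and $C^2$-smooth $f$ on $\mathcal M$, a minimizer $\beta_\star$ of $f$ over $\mathcal M$ is tilt-stable if for some $\varepsilon>0$ the map $\sigma(v)=\operatorname{argmin}_{\beta\in\mathcal M\cap B_\varepsilon(\beta_\star)}\{f(\beta)-\langle v,\beta\rangle\}$ satisfies $\sigma(0)=\beta_\star$ and is single-valued and $C^1$-smooth on a neighborhood of the origin; then $\mathrm{REG}=\|\nabla\sigma(0)\|_{\rm op}$. Otherwise the minimizer is called unstable and $\mathrm{REG}=+\infty$. For a maximization problem these notions are applied to the minimization of the negated objective. For $\mu\in\mathcal P_2^\circ$, $\mathrm{REG}(\mu)$ is the regularity modulus of the problem $\max_{v\in\mathbb S^{d-1}}\mathbb E_{x\sim\mu}\tfrac12\langle v,x\rangle^2$ at a maximizer (when $\mu\notin\mathcal E$ there are exactly two maximizers $\pm v_\star$, with the same modulus). RSE (unsupervised, permissible set $\mathcal P_2^\circ$): $\mathcal E=\{\mu\in\mathcal P_2^\circ:\text{the problem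 }\max_{v\in\mathbb S^{d-1}}\mathbb E_{x\sim\mu}\tfrac12\langle v,x\rangle^2\text{ has an unstable maximizer}\}$ and $\mathrm{RSE}(\mathsf D)=W_2(\mathsf D,\mathcal E)$. *)

theory Defs
  imports "HOL-Probability.Probability" "HOL-Computational_Algebra.Polynomial"
begin

definition centered_P2 :: "(real^'n) measure set" where
  "centered_P2 = {\<mu>. sets \<mu> = sets borel \<and> prob_space \<mu> \<and>
     integrable \<mu> (\<lambda>x. (norm x)\<^sup>2) \<and> (\<integral>x. x \<partial>\<mu>) = 0}"

definition second_moment :: "(real^'n) measure \<Rightarrow> real^'n^'n" where
  "second_moment \<mu> = (\<chi> i j. \<integral>x. x $ i * x $ j \<partial>\<mu>)"

definition charpoly :: "real^'n^'n \<Rightarrow> real poly" where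
  "charpoly A = det (\<chi> i j. (if i = j then [:0, 1:] else 0) - [:A $ i $ j:])"

text \<open>The \<open>k\<close>-th largest real eigenvalue, counted with algebraic multiplicity and starting at
  \<open>k = 1\<close>. For a symmetric matrix all roots of the characteristic polynomial are real, so the list
  has full length \<open>CARD('n)\<close>.\<close>
definition ordered_eigenvalue :: "nat \<Rightarrow> real^'n^'n \<Rightarrow> real" where
  "ordered_eigenvalue k A = rev (sorted_list_of_multiset (proots (charpoly A))) ! (k - 1)"

definition couplings :: "'a::euclidean_space measure \<Rightarrow> 'a measure \<Rightarrow> ('a \<times> 'a) measure set" where
  "couplings \<mu> \<nu> = {\<pi>. sets \<pi> = sets borel \<and> prob_space \<pi> \<and>
     distr \<pi> borel fst = \<mu> \<and> distr \<pi> borel snd = \<nu>}"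

text \<open>Meant for measures with finite second moment only: there the cost is integrable for every
  coupling and the infimum is attained.\<close>
definition W2 :: "'a::euclidean_space measure \<Rightarrow> 'a measure \<Rightarrow> real" where
  "W2 \<mu> \<nu> = (INF \<pi>\<in>couplings \<mu> \<nu>. sqrt (\<integral>(x, y). (norm (x - y))\<^sup>2 \<partial>\<pi>))"

text \<open>Extended real, so that the distance to the empty set is \<open>\<infinity>\<close>.\<close>
definition W2_set :: "'a::euclidean_space measure \<Rightarrow> 'a measure set \<Rightarrow> ereal" where
  "W2_set \<mu> \<E> = (INF \<nu>\<in>\<E>. ereal (W2 \<mu> \<nu>))"

definition minimizers :: "'a set \<Rightarrow> ('a \<Rightarrow> real) \<Rightarrow> 'a set" where
  "minimizers M f = {\<beta>\<in>M. \<forall>\<beta>'\<in>M. f \<beta> \<le> f \<beta>'}"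

definition maximizers :: "'a set \<Rightarrow> ('a \<Rightarrow> real) \<Rightarrow> 'a set" where
  "maximizers M f = {\<beta>\<in>M. \<forall>\<beta>'\<in>M. f \<beta>' \<le> f \<beta>}"

definition C1_smooth_on :: "('a::euclidean_space \<Rightarrow> 'b::euclidean_space) \<Rightarrow> 'a set \<Rightarrow> bool" where
  "C1_smooth_on f U \<longleftrightarrow>
     (\<exists>f'. (\<forall>x\<in>U. (f has_derivative blinfun_apply (f' x)) (at x)) \<and> continuous_on U f')"

text \<open>Taking the closed ball, rather than the open one, changes neither tilt-stability nor the
  regularity modulus below, since \<open>\<sigma>\<close> is required to be continuous with \<open>\<sigma>(0) = \<beta>\<close>.\<close>
definition tilt_argmin ::
  "'a::euclidean_space set \<Rightarrow> ('a \<Rightarrow> real) \<Rightarrow> 'a \<Rightarrow> real \<Rightarrow> 'a \<Rightarrow> 'a set" where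
  "tilt_argmin M f \<beta> \<epsilon> v = minimizers (M \<inter> cball \<beta> \<epsilon>) (\<lambda>x. f x - v \<bullet> x)"

text \<open>The map \<open>\<sigma>\<close>; its values matter only where the argmin is a singleton.\<close>
definition tilt_map ::
  "'a::euclidean_space set \<Rightarrow> ('a \<Rightarrow> real) \<Rightarrow> 'a \<Rightarrow> real \<Rightarrow> 'a \<Rightarrow> 'a" where
  "tilt_map M f \<beta> \<epsilon> v = the_elem (tilt_argmin M f \<beta> \<epsilon> v)"

definition tilt_radius ::
  "'a::euclidean_space set \<Rightarrow> ('a \<Rightarrow> real) \<Rightarrow> 'a \<Rightarrow> real \<Rightarrow> bool" where
  "tilt_radius M f \<beta> \<epsilon> \<longleftrightarrow> 0 < \<epsilon> \<and> tilt_argmin M f \<beta> \<epsilon> 0 = {\<beta>} \<and>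
     (\<exists>U. open U \<and> 0 \<in> U \<and> (\<forall>v\<in>U. is_singleton (tilt_argmin M f \<beta> \<epsilon> v)) \<and>
          C1_smooth_on (tilt_map M f \<beta> \<epsilon>) U)"

definition tilt_stable :: "'a::euclidean_space set \<Rightarrow> ('a \<Rightarrow> real) \<Rightarrow> 'a \<Rightarrow> bool" where
  "tilt_stable M f \<beta> \<longleftrightarrow> (\<exists>\<epsilon>. tilt_radius M f \<beta> \<epsilon>)"

text \<open>The germ of \<open>\<sigma>\<close> at the origin is the same for all admissible radii \<open>\<epsilon>\<close>: two such maps
  are continuous at the origin with value \<open>\<beta>\<close>, hence agree near it. So the choice below is
  immaterial.\<close>
definition regularity_modulus ::
  "'a::euclidean_space set \<Rightarrow> ('a \<Rightarrow> real) \<Rightarrow> 'a \<Rightarrow> ereal" where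
  "regularity_modulus M f \<beta> =
     (if tilt_stable M f \<beta>
      then ereal (onorm (frechet_derivative (tilt_map M f \<beta> (SOME \<epsilon>. tilt_radius M f \<beta> \<epsilon>)) (at 0)))
      else \<infinity>)"

definition pca_objective :: "(real^'n) measure \<Rightarrow> real^'n \<Rightarrow> real" where
  "pca_objective \<mu> v = (\<integral>x. 1/2 * (v \<bullet> x)\<^sup>2 \<partial>\<mu>)"

definition pca_maximizers :: "(real^'n) measure \<Rightarrow> (real^'n) set" where
  "pca_maximizers \<mu> = maximizers (sphere 0 1) (pca_objective \<mu>)"

text \<open>For maximization, stability and the regularity modulus refer to the negated objective.\<close>
definition pca_unstable :: "(real^'n) measure set" where
  "pca_unstable = {\<mu>\<in>centered_P2.
     \<exists>v\<in>pca_maximizers \<mu>. \<not> tilt_stable (sphere 0 1) (\<lambda>u. - pca_objective \<mu> u) v}"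

text \<open>Indexed by the maximizer \<open>v\<close> at which the modulus is taken. If \<open>\<mu>\<close> is not in
  \<open>pca_unstable\<close>, there are exactly two maximizers \<open>\<plusminus>v\<close>, with the same modulus.\<close>
definition pca_REG :: "(real^'n) measure \<Rightarrow> real^'n \<Rightarrow> ereal" where
  "pca_REG \<mu> v = regularity_modulus (sphere 0 1) (\<lambda>u. - pca_objective \<mu> u) v"

definition pca_RSE :: "(real^'n) measure \<Rightarrow> ereal" where
  "pca_RSE \<mu> = W2_set \<mu> pca_unstable"

end

theory Submission
  imports Defs
begin

text \<open>
  With \<open>\<Sigma>\<close> the second moment matrix, the objective is \<open>\<langle>v, \<Sigma> v\<rangle> / 2\<close>. If \<open>\<lambda>\<^sub>1 = \<lambda>\<^sub>2\<close> the maximizers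
  are not isolated, hence unstable. If \<open>\<lambda>\<^sub>1 > \<lambda>\<^sub>2\<close>, the inverse function theorem for the Lagrange
  system \<open>(\<kappa> u - \<Sigma> u, (|u|\<^sup>2 - 1) / 2) = (v, 0)\<close> yields a smooth tilt map whose derivative at the
  origin is the pseudoinverse of \<open>\<lambda>\<^sub>1 - \<Sigma>\<close>, of norm \<open>1 / (\<lambda>\<^sub>1 - \<lambda>\<^sub>2)\<close>. So the unstable measures
  are those with \<open>\<lambda>\<^sub>1 = \<lambda>\<^sub>2\<close>, and it remains to compute the distance to them: the lower bound
  compares standard deviations along two well-chosen orthonormal directions, and moving both
  \<open>\<surd>\<lambda>\<^sub>1\<close> and \<open>\<surd>\<lambda>\<^sub>2\<close> to their mean shows that it is attained.
\<close>

section \<open>The two largest eigenvalues of a symmetric matrix\<close>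

text \<open>Two obstacles shape the proof. First, the regularity modulus uses a radius picked by
  \<open>SOME\<close>, so the tilt map has to be controlled for every admissible radius and not just
  for a small one. When the top eigenvalue is simple these radii are exactly those in (0, 2): the
  objective is even, and the antipode of a maximizer, at distance 2, is a second one. Second, if the
  second eigenvalue is 0, no rescaling of coordinates can raise the deviation along its eigenvector;
  an independent coin is needed to create a new uncorrelated component. The factor 1 / sqrt 2
  expresses that two deviations, moved by \<open>a\<close> and \<open>b\<close> with
  \<open>a + b\<close> given, cost at least \<open>(a + b)^2 / 2\<close>, with equality when they
  share the move equally. In the final product the difference of square roots cancels, since the gap
  of the eigenvalues is that difference times the sum.\<close>

lemma linear_coeff_zero_of_nonneg_quadratic:
  fixes a b :: real
  assumes "\<And>t. 0 \<le> a * t + b * t\<^sup>2"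
  shows "a = 0"
proof (rule ccontr)
  assume "a \<noteq> 0"
  \<comment> \<open>Near 0 the linear term dominates. As \<open>k\<close> is positive and exceeds
    \<open>b\<close>, the point \<open>- a / k\<close> is close enough to 0 to make the sum
    negative.\<close>
  define k where "k = \<bar>b\<bar> + 1"
  have k: "k > 0" "b < k" by (auto simp: k_def)
  have "0 \<le> a * (- a / k) + b * (- a / k)\<^sup>2" by (rule assms)
  also have "\<dots> = (a\<^sup>2 / k\<^sup>2) * (b - k)"
    using k by (simp add: field_simps power2_eq_square)
  finally have "0 \<le> (a\<^sup>2 / k\<^sup>2) * (b - k)" .
  moreover have "(a\<^sup>2 / k\<^sup>2) * (b - k) < 0"
    using k \<open>a \<noteq> 0\<close> by (intro mult_pos_neg) auto
  ultimately show False by simp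
qed

text \<open>A maximizer \<open>e\<close> of the Rayleigh quotient on the unit sphere of
  \<open>S\<close> works: \<open>c * (x \<bullet> x) - x \<bullet> f x\<close> is nonnegative on
  \<open>S\<close> and zero at \<open>e\<close>, so its first variation at \<open>e\<close>
  vanishes.\<close>

lemma self_adjoint_has_eigenvector:
  fixes f :: "'a::euclidean_space \<Rightarrow> 'a"
  assumes f: "linear f" and sym: "\<And>x y. f x \<bullet> y = x \<bullet> f y"
    and S: "subspace S" "\<And>x. x \<in> S \<Longrightarrow> f x \<in> S" and "S \<noteq> {0}"
  obtains e c where "e \<in> S" "norm e = 1" "f e = c *\<^sub>R e"
proof -
  obtain y where "y \<in> S" "y \<noteq> 0"
    using S(1) \<open>S \<noteq> {0}\<close> subspace_0 by blast
  then have "(1 / norm y) *\<^sub>R y \<in> sphere 0 1 \<inter> S"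
    using S(1) by (auto simp: subspace_scale)
  then have ne: "sphere 0 1 \<inter> S \<noteq> {}" by blast
  have "compact (sphere 0 1 \<inter> S)"
    by (intro compact_Int_closed compact_sphere closed_subspace S)
  moreover have "continuous_on (sphere 0 1 \<inter> S) (\<lambda>x. x \<bullet> f x)"
    by (intro continuous_intros linear_continuous_on linear_conv_bounded_linear[THEN iffD1] f)
  ultimately obtain e where e: "e \<in> sphere 0 1" "e \<in> S"
    and max: "\<And>x. x \<in> sphere 0 1 \<Longrightarrow> x \<in> S \<Longrightarrow> x \<bullet> f x \<le> e \<bullet> f e"
    using continuous_attains_sup[OF _ ne] by blast
  define c where "c = e \<bullet> f e"
  have ee: "e \<bullet> e = 1" using e by (simp add: dot_square_norm)
  have le: "x \<bullet> f x \<le> c * (x \<bullet> x)" if "x \<in> S" for x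
  proof (cases "x = 0")
    case False
    have "((1 / norm x) *\<^sub>R x) \<bullet> f ((1 / norm x) *\<^sub>R x) \<le> c"
      unfolding c_def using False that S(1) by (intro max) (auto simp: subspace_scale)
    then show ?thesis
      using False by (simp add: linear_scale[OF f] field_simps power2_eq_square dot_square_norm)
  qed (simp add: linear_0[OF f])
  \<comment> \<open>The residual itself serves as direction of variation: it lies in
    \<open>S\<close> by invariance, and its first-order coefficient is twice
    \<open>h \<bullet> h\<close>.\<close>
  define h where "h = c *\<^sub>R e - f e"
  have h: "h \<in> S" unfolding h_def using e S by (auto intro: subspace_diff subspace_scale)
  have "0 \<le> (2 * (c * (e \<bullet> h) - f e \<bullet> h)) * t + (c * (h \<bullet> h) - h \<bullet> f h) * t\<^sup>2" for t
  proof -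
    have "(e + t *\<^sub>R h) \<bullet> f (e + t *\<^sub>R h) \<le> c * ((e + t *\<^sub>R h) \<bullet> (e + t *\<^sub>R h))"
      using h e S by (intro le) (auto intro: subspace_add subspace_scale)
    moreover have "h \<bullet> f e = f e \<bullet> h" "e \<bullet> f h = f e \<bullet> h" "h \<bullet> e = e \<bullet> h"
      using sym by (simp_all add: inner_commute)
    ultimately show ?thesis
      using ee by (simp add: linear_add[OF f] linear_scale[OF f] inner_simps c_def[symmetric]
          power2_eq_square algebra_simps)
  qed
  then have "c * (e \<bullet> h) - f e \<bullet> h = 0"
    using linear_coeff_zero_of_nonneg_quadratic by (metis mult_eq_0_iff zero_neq_numeral)
  then have "h \<bullet> h = 0"
    by (subst (1) h_def) (simp add: inner_simps)
  then have "f e = c *\<^sub>R e" by (simp add: h_def)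
  with e show ?thesis by (intro that) auto
qed

text \<open>By self-adjointness the orthogonal complement of an eigenvector within \<open>S\<close>
  is again invariant. Speaking of invariant subspaces rather than the whole space lets the induction
  on the dimension pass to it.\<close>

lemma self_adjoint_orthonormal_eigenbasis:
  fixes f :: "'a::euclidean_space \<Rightarrow> 'a"
  assumes f: "linear f" and sym: "\<And>x y. f x \<bullet> y = x \<bullet> f y"
    and "subspace S" "\<And>x. x \<in> S \<Longrightarrow> f x \<in> S"
  shows "\<exists>B \<subseteq> S. pairwise orthogonal B \<and> (\<forall>b\<in>B. norm b = 1 \<and> (\<exists>c. f b = c *\<^sub>R b)) \<and> S \<subseteq> span B"
  using assms(3,4)
proof (induction "dim S" arbitrary: S rule: less_induct)
  case less
  show ?case
  proof (cases "S = {0}")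
    case True
    then show ?thesis by (intro exI[of _ "{}"]) auto
  next
    case False
    obtain e c where e: "e \<in> S" "norm e = 1" "f e = c *\<^sub>R e"
      using self_adjoint_has_eigenvector[OF f sym less.prems False] .
    have ee: "e \<bullet> e = 1" using e by (simp add: dot_square_norm)
    let ?T = "S \<inter> {x. e \<bullet> x = 0}"
    have T: "subspace ?T" by (intro subspace_inter subspace_hyperplane less.prems)
    have "e \<notin> ?T" using ee by simp
    then have "?T \<subset> S" using e by blast
    then have "dim ?T < dim S"
      using T less.prems(1) by (intro dim_psubset) (simp add: span_eq_iff[THEN iffD2])
    moreover have "f x \<in> ?T" if "x \<in> ?T" for x
      using that less.prems(2) sym[of e x] e by auto
    ultimately obtain B where B: "B \<subseteq> ?T" "pairwise orthogonal B"
      "\<And>b. b \<in> B \<Longrightarrow> norm b = 1 \<and> (\<exists>c. f b = c *\<^sub>R b)" "?T \<subseteq> span B"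
      using less.hyps[OF _ T] by blast
    have "S \<subseteq> span (insert e B)"
    proof
      fix x assume "x \<in> S"
      then have "x - (e \<bullet> x) *\<^sub>R e \<in> ?T"
        using e ee less.prems(1) by (auto simp: inner_simps intro: subspace_diff subspace_scale)
      then have "x - (e \<bullet> x) *\<^sub>R e \<in> span B" using B(4) by blast
      then show "x \<in> span (insert e B)" by (auto simp: span_insert)
    qed
    moreover have "pairwise orthogonal (insert e B)"
      using B by (auto simp: pairwise_insert orthogonal_def inner_commute)
    ultimately show ?thesis using B e by (intro exI[of _ "insert e B"]) auto
  qed
qed

text \<open>Indexing the basis by \<open>'n\<close> turns the eigenvalues into a family with
  multiplicities repeated, as needed to factor the characteristic polynomial.\<close>

lemma symmetric_matrix_eigenbasis:
  fixes A :: "real^'n^'n"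
  assumes "transpose A = A"
  obtains e :: "'n \<Rightarrow> real^'n" and d :: "'n \<Rightarrow> real"
  where "\<And>i j. e i \<bullet> e j = (if i = j then 1 else 0)" "\<And>i. A *v e i = d i *\<^sub>R e i"
proof -
  have sym: "(A *v x) \<bullet> y = x \<bullet> (A *v y)" for x y
    by (metis assms dot_lmul_matrix vector_transpose_matrix)
  have "\<exists>B \<subseteq> UNIV. pairwise orthogonal B \<and> (\<forall>b\<in>B. norm b = 1 \<and> (\<exists>c. A *v b = c *\<^sub>R b)) \<and> UNIV \<subseteq> span B"
    by (rule self_adjoint_orthonormal_eigenbasis) (auto simp: sym)
  then obtain B where B: "pairwise orthogonal B"
    "\<And>b. b \<in> B \<Longrightarrow> norm b = 1" "\<And>b. b \<in> B \<Longrightarrow> (\<exists>c. A *v b = c *\<^sub>R b)" "span B = UNIV" by auto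
  have "independent B"
    using B(1,2) by (intro pairwise_orthogonal_independent) force+
  then have "card B = CARD('n)" "finite B"
    using B(4) dim_span_eq_card_independent[of B] independent_imp_finite by fastforce+
  then obtain e where e: "bij_betw e (UNIV :: 'n set) B"
    using finite_same_card_bij[of "UNIV :: 'n set" B] by auto
  then have eB: "e i \<in> B" for i by (auto simp: bij_betw_def)
  then obtain d where d: "\<And>i. A *v e i = d i *\<^sub>R e i" using B(3)[OF eB] by metis
  have "e i \<bullet> e j = (if i = j then 1 else 0)" for i j
  proof (cases "i = j")
    case True
    then show ?thesis using B(2)[OF eB[of i]] by (simp add: dot_square_norm)
  next
    case False
    then have "e i \<noteq> e j" using e by (auto simp: bij_betw_def inj_on_def)
    then show ?thesis using B(1) eB[of i] eB[of j] False by (auto simp: pairwise_def orthogonal_def)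
  qed
  with d show ?thesis using that by blast
qed

text \<open>Ordered eigenvalues are read from the roots of a polynomial, while all estimates use
  eigenvectors; this links the two. Evaluating at each real \<open>t\<close> replaces the
  determinant of a polynomial matrix by that of \<open>mat t - A\<close>, which the eigenbasis
  diagonalizes.\<close>

lemma charpoly_eq_prod_of_eigenbasis:
  fixes A :: "real^'n^'n" and e :: "'n \<Rightarrow> real^'n"
  assumes e: "\<And>i j. e i \<bullet> e j = (if i = j then 1 else 0)" and d: "\<And>i. A *v e i = d i *\<^sub>R e i"
  shows "charpoly A = (\<Prod>i\<in>UNIV. [:- d i, 1:])"
proof -
  define Q :: "real^'n^'n" where "Q = (\<chi> i j. e j $ i)"
  have col: "column i Q = e i" for i by (simp add: Q_def column_def vec_eq_iff)
  have Q: "orthogonal_matrix Q"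
    unfolding orthogonal_matrix_orthonormal_columns col orthogonal_def
    using e by (simp add: norm_eq_sqrt_inner)
  then have QQ: "transpose Q ** Q = mat 1" "Q ** transpose Q = mat 1"
    by (auto simp: orthogonal_matrix_def)
  have "poly (charpoly A) t = poly (\<Prod>i\<in>UNIV. [:- d i, 1:]) t" for t
  proof -
    define L :: "real^'n^'n" where "L = (\<chi> i j. if i = j then t - d i else 0)"
    have "poly (charpoly A) t = det (mat t - A)"
      unfolding charpoly_def det_def mat_def
      by (auto simp: poly_sum poly_prod intro!: sum.cong prod.cong)
    also have "(mat t - A) ** Q = Q ** L"
    proof -
      have "((mat t - A) ** Q) $ i $ j = (Q ** L) $ i $ j" for i j
      proof -
        have "((mat t - A) ** Q) $ i $ j = ((mat t - A) *v e j) $ i"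
          by (simp add: matrix_matrix_mult_def matrix_vector_mult_def Q_def)
        also have "(mat t - A) *v e j = t *\<^sub>R e j - d j *\<^sub>R e j"
        proof -
          have "mat t *v e j = t *\<^sub>R e j"
            by (simp add: vec_eq_iff mat_def matrix_vector_mult_def if_distrib
                [where f = "\<lambda>x. x * _"] cong: if_cong)
          then show ?thesis by (simp add: matrix_vector_mult_diff_rdistrib d)
        qed
        also have "\<dots> $ i = (Q ** L) $ i $ j"
          by (simp add: matrix_matrix_mult_def Q_def L_def if_distrib[where f = "\<lambda>x. _ * x"]
              algebra_simps cong: if_cong)
        finally show ?thesis .
      qed
      then show ?thesis by (simp add: vec_eq_iff)
    qed
    then have "mat t - A = Q ** L ** transpose Q"
      by (metis QQ(2) matrix_mul_assoc matrix_mul_rid)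
    also have "det \<dots> = det (transpose Q ** Q) * det L"
      by (simp add: det_mul)
    also have "\<dots> = det L" by (simp add: QQ)
    also have "\<dots> = (\<Prod>i\<in>UNIV. t - d i)"
      unfolding L_def by (subst det_diagonal) auto
    finally show ?thesis by (simp add: poly_prod)
  qed
  then show ?thesis by (simp add: poly_eq_poly_eq_iff[symmetric] fun_eq_iff)
qed

text \<open>Reversed, the list begins with \<open>a\<close>, \<open>b\<close>: these are the
  positions 0 and 1 that \<open>ordered_eigenvalue\<close> reads for \<open>k = 1\<close> and
  \<open>k = 2\<close>.\<close>

lemma sorted_list_of_multiset_top_two:
  fixes a b :: "'a::linorder"
  assumes "b \<le> a" "\<And>x. x \<in># M \<Longrightarrow> x \<le> b"
  shows "sorted_list_of_multiset (add_mset a (add_mset b M)) = sorted_list_of_multiset M @ [b, a]"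
proof -
  let ?s = "sorted_list_of_multiset M"
  have "sorted (?s @ [b, a])"
    using assms by (auto simp: sorted_append intro: order_trans)
  then have "sorted_list_of_multiset (mset (?s @ [b, a])) = ?s @ [b, a]"
    by (simp only: sorted_list_of_multiset_mset sorted_sort_id)
  then show ?thesis by (simp add: add_mset_commute)
qed

lemma orthonormal_family_expansion:
  fixes e :: "'n::finite \<Rightarrow> real^'n"
  assumes e: "\<And>i j. e i \<bullet> e j = (if i = j then 1 else 0)"
  shows "x = (\<Sum>i\<in>UNIV. (e i \<bullet> x) *\<^sub>R e i)"
proof -
  define Q :: "real^'n^'n" where "Q = (\<chi> i j. e i $ j)"
  have "row i Q = e i" for i by (simp add: Q_def row_def vec_eq_iff)
  then have "orthogonal_matrix Q"
    unfolding orthogonal_matrix_orthonormal_rows orthogonal_def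
    using e by (simp add: norm_eq_sqrt_inner)
  then have "x = transpose Q *v (Q *v x)"
    by (simp add: orthogonal_matrix_def matrix_vector_mul_assoc)
  also have "\<dots> = (\<Sum>i\<in>UNIV. (e i \<bullet> x) *\<^sub>R e i)"
    by (simp add: vec_eq_iff matrix_vector_mult_def transpose_def Q_def inner_vec_def mult.commute)
  finally show ?thesis .
qed

text \<open>The second index maximizes over the indices other than the first, not over smaller
  eigenvalues, so \<open>e1\<close> and \<open>e2\<close> are orthonormal even when the top
  eigenvalue is multiple.\<close>

lemma symmetric_matrix_top_eigenpair:
  fixes A :: "real^'n^'n"
  assumes "transpose A = A" and "CARD('n) \<ge> 2"
  obtains e1 e2 where "norm e1 = 1" "norm e2 = 1" "e1 \<bullet> e2 = 0"
    "A *v e1 = ordered_eigenvalue 1 A *\<^sub>R e1" "A *v e2 = ordered_eigenvalue 2 A *\<^sub>R e2"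
    "ordered_eigenvalue 2 A \<le> ordered_eigenvalue 1 A"
    "\<And>w. e1 \<bullet> w = 0 \<Longrightarrow> w \<bullet> (A *v w) \<le> ordered_eigenvalue 2 A * (norm w)\<^sup>2"
proof -
  obtain e :: "'n \<Rightarrow> real^'n" and d where
    e: "\<And>i j. e i \<bullet> e j = (if i = j then 1 else 0)" and d: "\<And>i. A *v e i = d i *\<^sub>R e i"
    using symmetric_matrix_eigenbasis[OF assms(1)] by blast
  obtain i1 where i1: "\<And>j. d j \<le> d i1"
    using Max_in[of "range d"] Max_ge[of "range d"] by fastforce
  have "UNIV - {i1} \<noteq> {}"
  proof
    assume "UNIV - {i1} = {}"
    then have "UNIV = {i1}" by blast
    then have "CARD('n) = 1" by (metis card_1_singleton_iff One_nat_def)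
    with assms(2) show False by simp
  qed
  then obtain i2 where i2: "i2 \<noteq> i1" "\<And>j. j \<noteq> i1 \<Longrightarrow> d j \<le> d i2"
    using Max_in[of "d ` (UNIV - {i1})"] Max_ge[of "d ` (UNIV - {i1})"] by fastforce
  define M where "M = image_mset d (mset_set (UNIV - {i1, i2}))"
  have "proots (charpoly A) = (\<Sum>i\<in>UNIV. proots [:- d i, 1:])"
    unfolding charpoly_eq_prod_of_eigenbasis[OF e d] by (rule proots_prod) simp
  also have "\<dots> = (\<Sum>i\<in>UNIV. {#d i#})" by simp
  also have "\<dots> = {#d i1#} + ({#d i2#} + (\<Sum>i\<in>UNIV - {i1} - {i2}. {#d i#}))"
    using i2 by (simp add: sum.remove[of UNIV i1] sum.remove[of "UNIV - {i1}" i2])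
  also have "UNIV - {i1} - {i2} = UNIV - {i1, i2}" by auto
  finally have "proots (charpoly A) = add_mset (d i1) (add_mset (d i2) M)"
    by (simp add: M_def sum_unfold_sum_mset)
  moreover have "\<And>x. x \<in># M \<Longrightarrow> x \<le> d i2"
    unfolding M_def using i2(2) by auto
  ultimately have "sorted_list_of_multiset (proots (charpoly A)) = sorted_list_of_multiset M @ [d i2, d i1]"
    using sorted_list_of_multiset_top_two[OF i1] by metis
  then have ev: "ordered_eigenvalue 1 A = d i1" "ordered_eigenvalue 2 A = d i2"
    by (simp_all add: ordered_eigenvalue_def)
  have "w \<bullet> (A *v w) \<le> d i2 * (norm w)\<^sup>2" if "e i1 \<bullet> w = 0" for w
  proof -
    note w = orthonormal_family_expansion[OF e, of w]
    have "(A *v w) = A *v (\<Sum>i\<in>UNIV. (e i \<bullet> w) *\<^sub>R e i)"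
      using w by simp
    also have "\<dots> = (\<Sum>i\<in>UNIV. (e i \<bullet> w) *\<^sub>R (d i *\<^sub>R e i))"
      by (simp add: linear_sum[OF matrix_vector_mul_linear] matrix_vector_mult_scaleR d)
    finally have "w \<bullet> (A *v w) = (\<Sum>i\<in>UNIV. d i * (e i \<bullet> w)\<^sup>2)"
      by (simp add: inner_sum_right inner_commute power2_eq_square mult_ac)
    also have "\<dots> \<le> (\<Sum>i\<in>UNIV. d i2 * (e i \<bullet> w)\<^sup>2)"
    proof (rule sum_mono)
      \<comment> \<open>The term of \<open>i1\<close> is zero because \<open>w\<close> is orthogonal
        to \<open>e i1\<close>; every other eigenvalue is at most \<open>d i2\<close>.\<close>
      fix i show "d i * (e i \<bullet> w)\<^sup>2 \<le> d i2 * (e i \<bullet> w)\<^sup>2"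
        using i2(2)[of i] that by (cases "i = i1") (auto intro: mult_right_mono)
    qed
    also have "\<dots> = d i2 * (w \<bullet> (\<Sum>i\<in>UNIV. (e i \<bullet> w) *\<^sub>R e i))"
      by (simp add: inner_sum_right inner_commute power2_eq_square sum_distrib_left)
    finally show ?thesis using w by (simp add: power2_norm_eq_inner)
  qed
  then show ?thesis
    using e d i1 i2 by (intro that[of "e i1" "e i2", unfolded ev]) (auto simp: norm_eq_sqrt_inner)
qed

section \<open>Tilt stability of a simple top eigenvector\<close>

text \<open>\<open>C1_smooth_on\<close> asks for continuity of the derivative in operator norm, and
  the derivative of a local inverse is a pointwise inverse. The reason is the resolvent identity
  \<open>g y - g y0 = - (g y o\<^sub>L (f y - f y0) o\<^sub>L g y0)\<close>, once \<open>g\<close>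
  is known to be bounded near \<open>y0\<close>.\<close>

lemma continuous_on_blinfun_inverse:
  fixes f g :: "'b::topological_space \<Rightarrow> ('a::real_normed_vector \<Rightarrow>\<^sub>L 'a)"
  assumes f: "continuous_on V f"
    and fg: "\<And>y. y \<in> V \<Longrightarrow> f y o\<^sub>L g y = id_blinfun"
    and gf: "\<And>y. y \<in> V \<Longrightarrow> g y o\<^sub>L f y = id_blinfun"
  shows "continuous_on V g"
  unfolding continuous_on_def
proof
  fix y0 assume y0: "y0 \<in> V"
  \<comment> \<open>When \<open>f y\<close> is within \<open>1 / (2 * M)\<close> of
    \<open>f y0\<close>, the identity gives
    \<open>norm (g y) \<le> norm (g y0) + norm (g y) / 2\<close>, hence the local bound
    \<open>2 * M\<close>. Adding 1 keeps \<open>M\<close> positive.\<close>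
  define M where "M = norm (g y0) + 1"
  have M: "M > 0" "norm (g y0) \<le> M" by (auto simp: M_def add_nonneg_pos)
  have ev: "\<forall>\<^sub>F y in at y0 within V. y \<in> V" by (auto simp: eventually_at_filter)
  have lim: "((\<lambda>y. norm (f y - f y0)) \<longlongrightarrow> 0) (at y0 within V)"
    using f y0 by (simp add: continuous_on_def tendsto_norm_zero LIM_zero)
  have diff: "norm (g y - g y0) \<le> norm (g y) * norm (f y - f y0) * norm (g y0)" if "y \<in> V" for y
  proof -
    have "blinfun_apply (g y - g y0) x = - blinfun_apply (g y o\<^sub>L (f y - f y0) o\<^sub>L g y0) x" for x
    proof -
      have "blinfun_apply (f y0) (blinfun_apply (g y0) x) = x"
        "blinfun_apply (g y) (blinfun_apply (f y) (blinfun_apply (g y0) x)) = blinfun_apply (g y0) x"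
        using fg[OF y0] gf[OF that]
        by (metis blinfun_apply_blinfun_compose blinfun_apply_id_blinfun)+
      then show ?thesis by (simp add: blinfun.bilinear_simps)
    qed
    then have "g y - g y0 = - (g y o\<^sub>L (f y - f y0) o\<^sub>L g y0)"
      by (intro blinfun_eqI) (simp add: blinfun.bilinear_simps)
    then have "norm (g y - g y0) = norm (g y o\<^sub>L (f y - f y0) o\<^sub>L g y0)" by simp
    also have "\<dots> \<le> norm (g y o\<^sub>L (f y - f y0)) * norm (g y0)" by (rule norm_blinfun_compose)
    also have "\<dots> \<le> norm (g y) * norm (f y - f y0) * norm (g y0)"
      by (intro mult_right_mono norm_blinfun_compose) auto
    finally show ?thesis .
  qed
  have "\<forall>\<^sub>F y in at y0 within V. norm (f y - f y0) < 1 / (2 * M)"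
    using lim M by (intro order_tendstoD) auto
  with ev have "\<forall>\<^sub>F y in at y0 within V. norm (g y - g y0) \<le> norm (f y - f y0) * (2 * M * M)"
  proof eventually_elim
    case (elim y)
    have "norm (g y) \<le> norm (g y0) + norm (g y - g y0)" by (metis add_diff_cancel_left' norm_triangle_sub)
    also have "norm (g y - g y0) \<le> norm (g y) * (norm (f y - f y0) * norm (g y0))"
      using diff[OF elim(1)] by (simp add: mult_ac)
    also have "norm (f y - f y0) * norm (g y0) \<le> 1 / (2 * M) * M"
      using elim M by (intro mult_mono) auto
    then have "norm (g y) * (norm (f y - f y0) * norm (g y0)) \<le> norm (g y) * (1 / 2)"
      using M by (intro mult_left_mono) auto
    finally have "norm (g y) \<le> 2 * M" using M by simp
    then have "norm (g y) * norm (f y - f y0) * norm (g y0) \<le> (2 * M) * norm (f y - f y0) * M"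
      using M by (intro mult_mono) auto
    then show ?case using diff[OF elim(1)] by (simp add: mult_ac)
  qed
  then have "((\<lambda>y. g y - g y0) \<longlongrightarrow> 0) (at y0 within V)"
    by (rule Lim_null_comparison) (intro tendsto_mult_left_zero lim)
  then show "(g \<longlongrightarrow> g y0) (at y0 within V)" by (rule LIM_zero_cancel)
qed

lemma minimizers_eq_singletonI:
  assumes "s \<in> S" "\<And>x. x \<in> S \<Longrightarrow> x \<noteq> s \<Longrightarrow> f s < f x"
  shows "minimizers S f = {s}"
  using assms unfolding minimizers_def by (auto simp: less_imp_le dest: leD) (metis less_imp_le order_refl)

text \<open>The gap is added only in \<open>simple_top_eigenvalue\<close>, because this locale is
  also instantiated with \<open>l1 = l2\<close>, for unstable measures.\<close>

locale top_eigenvalue =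
  fixes A :: "'a::euclidean_space \<Rightarrow> 'a" and \<beta> :: 'a and l1 l2 :: real
  assumes lin: "linear A" and sym: "\<And>x y. A x \<bullet> y = x \<bullet> A y"
    and unit: "norm \<beta> = 1" and eig: "A \<beta> = l1 *\<^sub>R \<beta>"
    and le: "\<And>w. \<beta> \<bullet> w = 0 \<Longrightarrow> w \<bullet> A w \<le> l2 * (norm w)\<^sup>2"
begin

lemma bounded_linear_A: "bounded_linear A"
  using lin by (simp add: linear_conv_bounded_linear)

lemma beta_inner: "\<beta> \<bullet> \<beta> = 1"
  using unit by (simp add: dot_square_norm)

text \<open>Split \<open>h\<close> along \<open>\<beta>\<close> and its complement; the mixed terms
  vanish because \<open>\<beta>\<close> is an eigenvector of a self-adjoint map.\<close>

lemma quadratic_form_le: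
  "h \<bullet> A h \<le> l2 * (norm h)\<^sup>2 + (l1 - l2) * (\<beta> \<bullet> h)\<^sup>2"
proof -
  define a where "a = \<beta> \<bullet> h"
  define w where "w = h - a *\<^sub>R \<beta>"
  have w: "\<beta> \<bullet> w = 0" by (simp add: w_def a_def inner_simps beta_inner)
  then have w': "w \<bullet> \<beta> = 0" "\<beta> \<bullet> A w = 0" "w \<bullet> A \<beta> = 0"
    using sym[of \<beta> w] by (simp_all add: inner_commute eig)
  have h: "h = a *\<^sub>R \<beta> + w" by (simp add: w_def)
  have "h \<bullet> A h = a\<^sup>2 * l1 + w \<bullet> A w"
    using w w' unfolding h
    by (simp add: linear_add[OF lin] linear_scale[OF lin] inner_simps eig beta_inner power2_eq_square)
  moreover have "(norm h)\<^sup>2 = a\<^sup>2 + (norm w)\<^sup>2"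
    using w w' unfolding h power2_norm_eq_inner by (simp add: inner_simps beta_inner power2_eq_square)
  ultimately show ?thesis using le[OF w] unfolding a_def[symmetric] by (simp add: algebra_simps)
qed

end

locale simple_top_eigenvalue = top_eigenvalue +
  assumes gap: "l2 < l1"
begin

text \<open>At a critical point \<open>u\<close> with multiplier \<open>\<kappa>\<close> the objective at \<open>u + h\<close> exceeds that at \<open>u\<close> by
  exactly \<open>\<langle>h, (\<kappa> - A) h\<rangle> / 2\<close>, because \<open>2 \<langle>u, h\<rangle> = - |h|\<^sup>2\<close> on the sphere.\<close>

lemma critical_point_strict_minimum:
  assumes u: "norm u = 1" and u': "norm u' = 1" "dist \<beta> u' \<le> \<epsilon>" "u' \<noteq> u"
    and crit: "\<kappa> *\<^sub>R u - A u = v"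
    and \<kappa>: "(l1 - l2) * (\<epsilon> / 2 + 3 / 2 * norm (u - \<beta>))\<^sup>2 < \<kappa> - l2"
  shows "- (1/2) * (u \<bullet> A u) - v \<bullet> u < - (1/2) * (u' \<bullet> A u') - v \<bullet> u'"
proof -
  define h where "h = u' - u"
  define \<delta> where "\<delta> = norm (u - \<beta>)"
  have h: "norm h > 0" using u' by (simp add: h_def)
  have uu: "u \<bullet> u = 1" "u' \<bullet> u' = 1" using u u' by (simp_all add: dot_square_norm)
  then have uh: "u \<bullet> h = - (norm h)\<^sup>2 / 2"
    unfolding power2_norm_eq_inner h_def by (simp add: inner_simps inner_commute)
  have "norm h \<le> norm (u' - \<beta>) + norm (u - \<beta>)"
    unfolding h_def by (metis norm_triangle_ineq4 diff_diff_eq2 diff_add_cancel add_diff_eq)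
  then have nh: "norm h \<le> \<epsilon> + \<delta>" using u' by (simp add: \<delta>_def dist_norm norm_minus_commute)
  \<comment> \<open>Along \<open>\<beta>\<close> the form can be as large as \<open>l1\<close>, so
    this component has to be controlled. It is, because \<open>u \<bullet> h\<close> is quadratic in
    \<open>h\<close>: the factor \<open>norm h / 2 + \<delta>\<close> together with
    \<open>norm h \<le> \<epsilon> + \<delta>\<close> yields the constant
    \<open>\<epsilon> / 2 + 3 / 2 * \<delta>\<close>.\<close>
  have "\<beta> \<bullet> h = u \<bullet> h - (u - \<beta>) \<bullet> h" by (simp add: inner_simps)
  then have "\<bar>\<beta> \<bullet> h\<bar> \<le> (norm h)\<^sup>2 / 2 + \<delta> * norm h"
    using Cauchy_Schwarz_ineq2[of "u - \<beta>" h] zero_le_power2[of "norm h"]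
    unfolding uh \<delta>_def by linarith
  also have "\<dots> = norm h * (norm h / 2 + \<delta>)" by (simp add: power2_eq_square algebra_simps)
  also have "\<dots> \<le> norm h * (\<epsilon> / 2 + 3 / 2 * \<delta>)" using nh by (intro mult_left_mono) auto
  finally have "\<bar>\<beta> \<bullet> h\<bar>\<^sup>2 \<le> (norm h * (\<epsilon> / 2 + 3 / 2 * \<delta>))\<^sup>2" by (intro power_mono) auto
  then have "(\<beta> \<bullet> h)\<^sup>2 \<le> (norm h)\<^sup>2 * (\<epsilon> / 2 + 3 / 2 * \<delta>)\<^sup>2" by (simp add: power_mult_distrib)
  then have "(l1 - l2) * (\<beta> \<bullet> h)\<^sup>2 \<le> (l1 - l2) * ((norm h)\<^sup>2 * (\<epsilon> / 2 + 3 / 2 * \<delta>)\<^sup>2)"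
    using gap by (intro mult_left_mono) auto
  also have "\<dots> = (norm h)\<^sup>2 * ((l1 - l2) * (\<epsilon> / 2 + 3 / 2 * \<delta>)\<^sup>2)" by simp
  also have "\<dots> < (norm h)\<^sup>2 * (\<kappa> - l2)"
    using \<kappa> h by (intro mult_strict_left_mono) (auto simp: \<delta>_def)
  finally have "h \<bullet> A h < \<kappa> * (norm h)\<^sup>2"
    using quadratic_form_le[of h] by (simp add: algebra_simps)
  moreover have "u' = u + h" by (simp add: h_def)
  moreover have "u \<bullet> A h = A u \<bullet> h" "h \<bullet> A u = A u \<bullet> h" by (simp_all only: sym inner_commute[of h])
  moreover have "v \<bullet> h = \<kappa> * (u \<bullet> h) - A u \<bullet> h" by (simp add: crit[symmetric] inner_simps)
  ultimately show ?thesis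
    using uh by (simp add: linear_add[OF lin] inner_simps add_divide_distrib)
qed

section \<open>The Lagrange system and its local inverse\<close>

definition lagrange_map :: "'a \<times> real \<Rightarrow> 'a \<times> real" where
  "lagrange_map p = (snd p *\<^sub>R fst p - A (fst p), (fst p \<bullet> fst p - 1) / 2)"

text \<open>The bordered Hessian. It is a bounded linear function object so that continuity in
  operator norm can be stated.\<close>

definition lagrange_deriv :: "'a \<times> real \<Rightarrow> ('a \<times> real) \<Rightarrow>\<^sub>L ('a \<times> real)" where
  "lagrange_deriv p = Blinfun (\<lambda>q. (snd q *\<^sub>R fst p + snd p *\<^sub>R fst q - A (fst q), fst p \<bullet> fst q))"

lemma lagrange_deriv_apply:
  "blinfun_apply (lagrange_deriv p) q = (snd q *\<^sub>R fst p + snd p *\<^sub>R fst q - A (fst q), fst p \<bullet> fst q)"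
proof -
  have "linear (\<lambda>q. (snd q *\<^sub>R fst p + snd p *\<^sub>R fst q - A (fst q), fst p \<bullet> fst q))"
    by (intro linearI) (auto simp: linear_add[OF lin] linear_scale[OF lin] algebra_simps inner_simps)
  then have "bounded_linear (\<lambda>q. (snd q *\<^sub>R fst p + snd p *\<^sub>R fst q - A (fst q), fst p \<bullet> fst q))"
    by (rule linear_conv_bounded_linear[THEN iffD1])
  then show ?thesis unfolding lagrange_deriv_def by (simp add: bounded_linear_Blinfun_apply)
qed

lemma has_derivative_lagrange_map: "(lagrange_map has_derivative blinfun_apply (lagrange_deriv p)) (at p)"
proof -
  have A: "((\<lambda>p. A (fst p)) has_derivative (\<lambda>q. A (fst q))) (at p)"
    by (intro bounded_linear.has_derivative[OF bounded_linear_A] has_derivative_fst has_derivative_ident)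
  have "((\<lambda>p. (snd p *\<^sub>R fst p - A (fst p), (fst p \<bullet> fst p - 1) / 2)) has_derivative
      (\<lambda>q. (snd p *\<^sub>R fst q + snd q *\<^sub>R fst p - A (fst q), (fst p \<bullet> fst q + fst q \<bullet> fst p - 0) / 2))) (at p)"
    by (intro has_derivative_Pair has_derivative_diff has_derivative_scaleR has_derivative_inner A
        has_derivative_fst has_derivative_snd has_derivative_ident has_derivative_const
        bounded_linear.has_derivative[OF bounded_linear_divide])
  then show ?thesis
    unfolding lagrange_map_def[abs_def]
    by (rule has_derivative_eq_rhs) (simp add: lagrange_deriv_apply fun_eq_iff inner_commute)
qed

lemma continuous_on_lagrange_deriv: "continuous_on S lagrange_deriv"
  by (rule continuous_on_blinfun_componentwise) (auto simp: lagrange_deriv_apply intro!: continuous_intros)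

text \<open>Pair the first component with \<open>\<beta>\<close> to find \<open>t\<close>, and with
  \<open>h\<close> to use that \<open>l1 - A\<close> is bounded below by \<open>l1 - l2\<close> on
  the complement of \<open>\<beta>\<close>. For \<open>v = 0\<close> this is injectivity; for
  general \<open>v\<close> it bounds the derivative of the tilt map.\<close>

lemma lagrange_deriv_at_eigenvector:
  assumes "blinfun_apply (lagrange_deriv (\<beta>, l1)) (h, t) = (v, 0)"
  shows "\<beta> \<bullet> h = 0" "(l1 - l2) * norm h \<le> norm v" "t = \<beta> \<bullet> v"
proof -
  have v: "t *\<^sub>R \<beta> + l1 *\<^sub>R h - A h = v" and h: "\<beta> \<bullet> h = 0"
    using assms by (simp_all add: lagrange_deriv_apply)
  show "\<beta> \<bullet> h = 0" by fact
  have "\<beta> \<bullet> A h = 0" using sym[of \<beta> h] h by (simp add: eig)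
  then show "t = \<beta> \<bullet> v" using h by (simp add: v[symmetric] inner_simps beta_inner)
  have "h \<bullet> v = l1 * (norm h)\<^sup>2 - h \<bullet> A h"
    using h by (simp add: v[symmetric] inner_simps power2_norm_eq_inner inner_commute)
  then have "(l1 - l2) * (norm h)\<^sup>2 \<le> norm h * norm v"
    using le[OF h] norm_cauchy_schwarz[of h v] by (simp add: algebra_simps)
  then have "norm h * ((l1 - l2) * norm h) \<le> norm h * norm v"
    by (simp add: power2_eq_square mult_ac)
  then show "(l1 - l2) * norm h \<le> norm v"
    by (cases "h = 0") auto
qed

text \<open>The gap makes the derivative at \<open>(\<beta>, l1)\<close> injective, so the inverse
  function theorem applies. The last fact lets the derivative of the tilt map be read off from the
  linearized system.\<close>

lemma lagrange_map_local_inverse: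
  obtains V g g' where "open V" "(0, 0) \<in> V" "g (0, 0) = (\<beta>, l1)" "continuous_on V g"
    "\<And>y. y \<in> V \<Longrightarrow> lagrange_map (g y) = y"
    "\<And>y. y \<in> V \<Longrightarrow> (g has_derivative blinfun_apply (g' y)) (at y)"
    "continuous_on V g'" "lagrange_deriv (\<beta>, l1) o\<^sub>L g' (0, 0) = id_blinfun"
proof -
  have lind: "linear (blinfun_apply (lagrange_deriv p))" for p
    by (rule bounded_linear.linear[OF blinfun.bounded_linear_right])
  have "inj (blinfun_apply (lagrange_deriv (\<beta>, l1)))"
    unfolding linear_injective_0[OF lind]
  proof (intro allI impI)
    fix q assume "blinfun_apply (lagrange_deriv (\<beta>, l1)) q = 0"
    then have "blinfun_apply (lagrange_deriv (\<beta>, l1)) (fst q, snd q) = (0, 0)"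
      by (simp add: zero_prod_def)
    from lagrange_deriv_at_eigenvector[OF this] gap show "q = 0"
      by (auto simp: prod_eq_iff mult_le_0_iff)
  qed
  then obtain linv where linv: "linear linv" "linv \<circ> blinfun_apply (lagrange_deriv (\<beta>, l1)) = id"
    using linear_injective_left_inverse[OF lind] by blast
  then have "bounded_linear linv" by (simp add: linear_conv_bounded_linear)
  then have "Blinfun linv o\<^sub>L lagrange_deriv (\<beta>, l1) = id_blinfun"
    using linv(2) by (intro blinfun_eqI) (auto simp: bounded_linear_Blinfun_apply fun_eq_iff)
  from inverse_function_theorem[OF open_UNIV has_derivative_lagrange_map continuous_on_lagrange_deriv
      UNIV_I this]
  obtain U V g g' where *: "open U" "(\<beta>, l1) \<in> U" "open V" "lagrange_map (\<beta>, l1) \<in> V"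
    "homeomorphism U V lagrange_map g"
    and der: "\<And>y. y \<in> V \<Longrightarrow> (g has_derivative g' y) (at y)"
    and g': "\<And>y. y \<in> V \<Longrightarrow> g' y = inv (blinfun_apply (lagrange_deriv (g y)))"
    and bij: "\<And>y. y \<in> V \<Longrightarrow> bij (blinfun_apply (lagrange_deriv (g y)))"
    by metis
  have l0: "lagrange_map (\<beta>, l1) = (0, 0)" by (simp add: lagrange_map_def eig beta_inner)
  have g0: "g (0, 0) = (\<beta>, l1)" using * by (metis homeomorphism_apply1 l0)
  have contg: "continuous_on V g" using * by (auto simp: homeomorphism_def)
  have app: "blinfun_apply (Blinfun (g' y)) = g' y" if "y \<in> V" for y
    using der[OF that] by (simp add: bounded_linear_Blinfun_apply has_derivative_bounded_linear)
  have right: "lagrange_deriv (g y) o\<^sub>L Blinfun (g' y) = id_blinfun" if "y \<in> V" for y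
    using bij[OF that] by (intro blinfun_eqI) (simp add: app[OF that], simp add: g'[OF that] bij_is_surj surj_f_inv_f)
  have left: "Blinfun (g' y) o\<^sub>L lagrange_deriv (g y) = id_blinfun" if "y \<in> V" for y
    using bij[OF that] by (intro blinfun_eqI) (simp add: app[OF that], simp add: g'[OF that] bij_is_inj)
  have "continuous_on V (\<lambda>y. lagrange_deriv (g y))"
    using continuous_on_compose[OF contg continuous_on_lagrange_deriv] by (simp add: o_def)
  then have "continuous_on V (\<lambda>y. Blinfun (g' y))"
    using right left by (rule continuous_on_blinfun_inverse)
  then show ?thesis
    using * der right[of "(0, 0)"] contg g0 l0
    by (intro that[of V g "\<lambda>y. Blinfun (g' y)"]) (auto simp: app homeomorphism_apply2)
qed

text \<open>The local inverse at \<open>(v, 0)\<close> supplies a critical point on the sphere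
  together with its multiplier, and the strict comparison at critical points makes it the only
  minimizer in the whole ball.\<close>

lemma tilt_argmin_local:
  assumes \<epsilon>: "0 < \<epsilon>" "\<epsilon> < 2"
  obtains U \<sigma> \<sigma>' where "open U" "0 \<in> U" "\<sigma> 0 = \<beta>"
    "\<And>v. v \<in> U \<Longrightarrow> tilt_argmin (sphere 0 1) (\<lambda>u. - (1/2) * (u \<bullet> A u)) \<beta> \<epsilon> v = {\<sigma> v}"
    "\<And>v. v \<in> U \<Longrightarrow> (\<sigma> has_derivative blinfun_apply (\<sigma>' v)) (at v)" "continuous_on U \<sigma>'"
    "\<And>v. \<exists>t. blinfun_apply (lagrange_deriv (\<beta>, l1)) (blinfun_apply (\<sigma>' 0) v, t) = (v, 0)"
proof -
  obtain V g g' where V: "open V" "(0, 0) \<in> V" "g (0, 0) = (\<beta>, l1)" "continuous_on V g"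
    and inv: "\<And>y. y \<in> V \<Longrightarrow> lagrange_map (g y) = y"
    and der: "\<And>y. y \<in> V \<Longrightarrow> (g has_derivative blinfun_apply (g' y)) (at y)"
    and g': "continuous_on V g'" "lagrange_deriv (\<beta>, l1) o\<^sub>L g' (0, 0) = id_blinfun"
    using lagrange_map_local_inverse by blast
  \<comment> \<open>The point lies in the ball and, with its multiplier, satisfies the curvature
    condition of \<open>critical_point_strict_minimum\<close>. Both conditions are open, so they
    persist for small tilts.\<close>
  define N where "N = {p. norm (fst p - \<beta>) < \<epsilon> \<and>
     (l1 - l2) * (\<epsilon> / 2 + 3 / 2 * norm (fst p - \<beta>))\<^sup>2 < snd p - l2}"
  have "open N" unfolding N_def
    by (intro open_Collect_conj open_Collect_less continuous_intros)
  define J :: "'a \<Rightarrow> 'a \<times> real" where "J v = (v, 0)" for v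
  define U where "U = J -` (V \<inter> g -` N)"
  have "open (V \<inter> g -` N)" using V \<open>open N\<close> by (simp add: continuous_on_open_vimage Int_commute)
  then have "open U" unfolding U_def J_def[abs_def]
    by (intro open_vimage) (auto intro!: continuous_intros)
  \<comment> \<open>At \<open>(\<beta>, l1)\<close> the distance term is 0 and, after division by
    the gap, the curvature condition reads \<open>(\<epsilon> / 2)^2 < 1\<close>.\<close>
  have "(\<epsilon> / 2)\<^sup>2 < 1" using \<epsilon> by (simp add: abs_square_less_1)
  then have "(l1 - l2) * (\<epsilon> / 2)\<^sup>2 < (l1 - l2) * 1" using gap by (intro mult_strict_left_mono) auto
  then have "0 \<in> U" using V \<epsilon> by (simp add: U_def J_def N_def)
  have J: "bounded_linear J" unfolding J_def[abs_def]
    by (intro bounded_linear_Pair bounded_linear_ident bounded_linear_zero)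
  define \<sigma> where "\<sigma> v = fst (g (J v))" for v
  define \<sigma>' where "\<sigma>' v = fst_blinfun o\<^sub>L g' (J v) o\<^sub>L Blinfun J" for v
  have J0: "J 0 = (0, 0)" by (simp add: J_def)
  show ?thesis
  proof (rule that[of U \<sigma> \<sigma>'])
    show "\<sigma> 0 = \<beta>" by (simp add: \<sigma>_def J0 V)
    fix v assume v: "v \<in> U"
    define \<kappa> where "\<kappa> = snd (g (J v))"
    have JV: "J v \<in> V" and gN: "(\<sigma> v, \<kappa>) \<in> N" using v by (auto simp: U_def \<sigma>_def \<kappa>_def)
    have "lagrange_map (\<sigma> v, \<kappa>) = (v, 0)" using inv[OF JV] by (simp add: \<sigma>_def \<kappa>_def J_def)
    then have crit: "\<kappa> *\<^sub>R \<sigma> v - A (\<sigma> v) = v" and n: "norm (\<sigma> v) = 1"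
      by (auto simp: lagrange_map_def norm_eq_1)
    have "\<sigma> v \<in> cball \<beta> \<epsilon>" using gN by (simp add: N_def dist_norm norm_minus_commute)
    moreover have "- (1/2) * (\<sigma> v \<bullet> A (\<sigma> v)) - v \<bullet> \<sigma> v < - (1/2) * (u' \<bullet> A u') - v \<bullet> u'"
      if "norm u' = 1" "dist \<beta> u' \<le> \<epsilon>" "u' \<noteq> \<sigma> v" for u'
      using critical_point_strict_minimum[OF n that crit] gN by (simp add: N_def)
    ultimately show "tilt_argmin (sphere 0 1) (\<lambda>u. - (1/2) * (u \<bullet> A u)) \<beta> \<epsilon> v = {\<sigma> v}"
      unfolding tilt_argmin_def using n by (intro minimizers_eq_singletonI) auto
    have "(g has_derivative blinfun_apply (g' (J v))) (at (J v))" by (rule der[OF JV])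
    from has_derivative_compose[OF bounded_linear.has_derivative[OF J has_derivative_ident] this]
    have "((\<lambda>x. g (J x)) has_derivative (\<lambda>h. blinfun_apply (g' (J v)) (J h))) (at v)" .
    from has_derivative_fst[OF this]
    show "(\<sigma> has_derivative blinfun_apply (\<sigma>' v)) (at v)"
      unfolding \<sigma>_def[abs_def] \<sigma>'_def by (simp add: bounded_linear_Blinfun_apply[OF J] o_def
        blinfun_compose.rep_eq fst_blinfun.rep_eq)
  next
    have "continuous_on U (\<lambda>v. g' (J v))"
      by (rule continuous_on_compose2[OF g'(1) linear_continuous_on[OF J]]) (auto simp: U_def)
    then show "continuous_on U \<sigma>'" unfolding \<sigma>'_def by (intro continuous_intros)
  next
    fix v
    show "\<exists>t. blinfun_apply (lagrange_deriv (\<beta>, l1)) (blinfun_apply (\<sigma>' 0) v, t) = (v, 0)"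
    proof (rule exI[of _ "snd (blinfun_apply (g' (0, 0)) (v, 0))"])
      have "blinfun_apply (lagrange_deriv (\<beta>, l1)) (blinfun_apply (g' (0, 0)) (v, 0)) = (v, 0)"
        using g'(2) by (metis blinfun_apply_blinfun_compose blinfun_apply_id_blinfun)
      then show "blinfun_apply (lagrange_deriv (\<beta>, l1))
          (blinfun_apply (\<sigma>' 0) v, snd (blinfun_apply (g' (0, 0)) (v, 0))) = (v, 0)"
        by (simp add: \<sigma>'_def J0 bounded_linear_Blinfun_apply[OF J] fst_blinfun.rep_eq
            del: lagrange_deriv_apply) (simp add: J_def)
    qed
  qed (fact \<open>open U\<close> \<open>0 \<in> U\<close>)+
qed

abbreviation neg_rayleigh :: "'a \<Rightarrow> real" where
  "neg_rayleigh \<equiv> \<lambda>u. - (1/2) * (u \<bullet> A u)"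

lemma tilt_radius_and_derivative:
  assumes \<epsilon>: "0 < \<epsilon>" "\<epsilon> < 2"
  obtains \<sigma>' where "tilt_radius (sphere 0 1) neg_rayleigh \<beta> \<epsilon>"
    "(tilt_map (sphere 0 1) neg_rayleigh \<beta> \<epsilon> has_derivative \<sigma>') (at 0)"
    "\<And>v. \<exists>t. blinfun_apply (lagrange_deriv (\<beta>, l1)) (\<sigma>' v, t) = (v, 0)"
proof -
  obtain U \<sigma> \<sigma>' where U: "open U" "0 \<in> U" "\<sigma> 0 = \<beta>"
    and arg: "\<And>v. v \<in> U \<Longrightarrow> tilt_argmin (sphere 0 1) neg_rayleigh \<beta> \<epsilon> v = {\<sigma> v}"
    and der: "\<And>v. v \<in> U \<Longrightarrow> (\<sigma> has_derivative blinfun_apply (\<sigma>' v)) (at v)"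
    and cont: "continuous_on U \<sigma>'"
    and eq: "\<And>v. \<exists>t. blinfun_apply (lagrange_deriv (\<beta>, l1)) (blinfun_apply (\<sigma>' 0) v, t) = (v, 0)"
    using tilt_argmin_local[OF \<epsilon>] by blast
  have "(tilt_map (sphere 0 1) neg_rayleigh \<beta> \<epsilon> has_derivative blinfun_apply (\<sigma>' v)) (at v)"
    if "v \<in> U" for v
    by (rule has_derivative_transform_within_open[OF der[OF that] U(1) that])
      (simp only: tilt_map_def arg the_elem_eq)
  note map_der = this
  moreover have "C1_smooth_on (tilt_map (sphere 0 1) neg_rayleigh \<beta> \<epsilon>) U"
    unfolding C1_smooth_on_def using map_der cont by blast
  then have "tilt_radius (sphere 0 1) neg_rayleigh \<beta> \<epsilon>"
    unfolding tilt_radius_def using \<epsilon>(1) U(1,2) arg[OF U(2)] U(3)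
    by (intro conjI exI[of _ U] ballI) (simp_all only: arg is_singletonI)
  ultimately show ?thesis using that U(2) eq by blast
qed

text \<open>The objective is even, so a ball reaching the antipode \<open>- \<beta>\<close> would
  contain a second minimizer at tilt 0. This brings the radius chosen by \<open>SOME\<close> into
  the range covered above.\<close>

lemma tilt_radius_lt_two:
  assumes "tilt_radius (sphere 0 1) neg_rayleigh \<beta> \<epsilon>"
  shows "\<epsilon> < 2"
proof (rule ccontr)
  assume "\<not> \<epsilon> < 2"
  moreover have d: "dist \<beta> (- \<beta>) = 2"
    using unit by (simp add: dist_norm scaleR_2[symmetric])
  moreover have "\<beta> \<in> tilt_argmin (sphere 0 1) neg_rayleigh \<beta> \<epsilon> 0"
    using assms by (simp add: tilt_radius_def)
  ultimately have "- \<beta> \<in> tilt_argmin (sphere 0 1) neg_rayleigh \<beta> \<epsilon> 0"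
    using unit by (auto simp: tilt_argmin_def minimizers_def linear_neg[OF lin])
  then have "- \<beta> = \<beta>" using assms by (simp add: tilt_radius_def)
  with d show False by simp
qed

lemma tilt_stable_top: "tilt_stable (sphere 0 1) neg_rayleigh \<beta>"
  unfolding tilt_stable_def using tilt_radius_and_derivative[of 1] by (metis one_less_numeral_iff
      semiring_norm(76) zero_less_one)

text \<open>The upper bound is the coercivity of the linearized system; tilting along an eigenvector
  of \<open>l2\<close> shows that it is sharp.\<close>

lemma regularity_modulus_top:
  assumes e: "norm e = 1" "\<beta> \<bullet> e = 0" "A e = l2 *\<^sub>R e"
  shows "regularity_modulus (sphere 0 1) neg_rayleigh \<beta> = ereal (1 / (l1 - l2))"
proof -
  define \<epsilon> where "\<epsilon> = (SOME \<epsilon>. tilt_radius (sphere 0 1) neg_rayleigh \<beta> \<epsilon>)"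
  have "tilt_radius (sphere 0 1) neg_rayleigh \<beta> \<epsilon>"
    unfolding \<epsilon>_def using tilt_stable_top unfolding tilt_stable_def by (rule someI_ex)
  then have \<epsilon>: "0 < \<epsilon>" "\<epsilon> < 2" using tilt_radius_lt_two by (auto simp: tilt_radius_def)
  obtain \<sigma>' where "tilt_radius (sphere 0 1) neg_rayleigh \<beta> \<epsilon>"
    and der: "(tilt_map (sphere 0 1) neg_rayleigh \<beta> \<epsilon> has_derivative \<sigma>') (at 0)"
    and eq: "\<And>v. \<exists>t. blinfun_apply (lagrange_deriv (\<beta>, l1)) (\<sigma>' v, t) = (v, 0)"
    using tilt_radius_and_derivative[OF \<epsilon>] by blast
  have "onorm \<sigma>' \<le> 1 / (l1 - l2)"
  proof (rule onorm_le)
    fix v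
    obtain t where "blinfun_apply (lagrange_deriv (\<beta>, l1)) (\<sigma>' v, t) = (v, 0)" using eq by blast
    from lagrange_deriv_at_eigenvector(2)[OF this]
    show "norm (\<sigma>' v) \<le> 1 / (l1 - l2) * norm v" using gap by (simp add: field_simps)
  qed
  moreover have "1 / (l1 - l2) \<le> onorm \<sigma>'"
  proof -
    obtain t where "blinfun_apply (lagrange_deriv (\<beta>, l1)) (\<sigma>' e, t) = (e, 0)" using eq by blast
    then have "t *\<^sub>R \<beta> + l1 *\<^sub>R \<sigma>' e - A (\<sigma>' e) = e" by (simp add: lagrange_deriv_apply)
    \<comment> \<open>Pairing with \<open>e\<close> removes the multiplier term, as \<open>e\<close>
      is orthogonal to \<open>\<beta>\<close>, and replaces \<open>A\<close> by
      \<open>l2\<close>.\<close>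
    then have "e \<bullet> (t *\<^sub>R \<beta> + l1 *\<^sub>R \<sigma>' e - A (\<sigma>' e)) = e \<bullet> e" by simp
    moreover have "e \<bullet> A (\<sigma>' e) = l2 * (e \<bullet> \<sigma>' e)" using sym[of e "\<sigma>' e"] e by simp
    ultimately have "(l1 - l2) * (e \<bullet> \<sigma>' e) = 1"
      using e by (simp add: inner_simps inner_commute dot_square_norm algebra_simps)
    then have "1 / (l1 - l2) = e \<bullet> \<sigma>' e" using gap by (simp add: field_simps)
    also have "\<dots> \<le> norm (\<sigma>' e)" using norm_cauchy_schwarz[of e "\<sigma>' e"] e by simp
    also have "\<dots> \<le> onorm \<sigma>'"
      using onorm[OF has_derivative_bounded_linear[OF der], of e] e by simp
    finally show ?thesis .
  qed
  ultimately have "onorm \<sigma>' = 1 / (l1 - l2)" by simp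
  then show ?thesis
    unfolding regularity_modulus_def \<epsilon>_def[symmetric]
    using tilt_stable_top frechet_derivative_at[OF der] by simp
qed

end

section \<open>Unstable measures\<close>

lemma borel_measurable_inner_P2:
  assumes "\<mu> \<in> centered_P2"
  shows "(\<lambda>x. u \<bullet> x) \<in> borel_measurable \<mu>"
proof -
  have "(\<lambda>x. u \<bullet> x) \<in> borel_measurable borel" by simp
  then show ?thesis using assms by (simp add: centered_P2_def cong: measurable_cong_sets)
qed

lemma integrable_inner_mult_P2:
  assumes "\<mu> \<in> centered_P2"
  shows "integrable \<mu> (\<lambda>x. (u \<bullet> x) * (v \<bullet> x))"
proof (rule Bochner_Integration.integrable_bound)
  show "integrable \<mu> (\<lambda>x. norm u * norm v * (norm x)\<^sup>2)"
    using assms by (simp add: centered_P2_def)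
  show "(\<lambda>x. (u \<bullet> x) * (v \<bullet> x)) \<in> borel_measurable \<mu>"
    using assms by (intro borel_measurable_times borel_measurable_inner_P2)
  have "norm ((u \<bullet> x) * (v \<bullet> x)) \<le> norm (norm u * norm v * (norm x)\<^sup>2)" for x
  proof -
    have "\<bar>u \<bullet> x\<bar> * \<bar>v \<bullet> x\<bar> \<le> (norm u * norm x) * (norm v * norm x)"
      by (intro mult_mono Cauchy_Schwarz_ineq2) auto
    then show ?thesis by (simp add: abs_mult power2_eq_square mult_ac)
  qed
  then show "AE x in \<mu>. norm ((u \<bullet> x) * (v \<bullet> x)) \<le> norm (norm u * norm v * (norm x)\<^sup>2)" by simp
qed

lemma integrable_inner_square_P2:
  assumes "\<mu> \<in> centered_P2"
  shows "integrable \<mu> (\<lambda>x. (u \<bullet> x)\<^sup>2)"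
  using integrable_inner_mult_P2[OF assms, of u u] by (simp add: power2_eq_square)

lemma integral_inner_mult:
  assumes "\<mu> \<in> centered_P2"
  shows "(\<integral>x. (u \<bullet> x) * (v \<bullet> x) \<partial>\<mu>) = u \<bullet> (second_moment \<mu> *v v)"
proof -
  have int: "integrable \<mu> (\<lambda>x. x $ i * x $ j)" for i j
    using integrable_inner_mult_P2[OF assms, of "axis i 1" "axis j 1"] by (simp add: inner_axis')
  have "(\<integral>x. (u \<bullet> x) * (v \<bullet> x) \<partial>\<mu>) = (\<integral>x. (\<Sum>i\<in>UNIV. \<Sum>j\<in>UNIV. (u $ i * v $ j) * (x $ i * x $ j)) \<partial>\<mu>)"
    by (simp add: inner_vec_def sum_product mult_ac)
  also have "\<dots> = (\<Sum>i\<in>UNIV. \<Sum>j\<in>UNIV. (u $ i * v $ j) * (\<integral>x. x $ i * x $ j \<partial>\<mu>))"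
    using int by (simp add: Bochner_Integration.integral_sum)
  also have "\<dots> = u \<bullet> (second_moment \<mu> *v v)"
    by (simp add: second_moment_def matrix_vector_mult_def inner_vec_def sum_distrib_left mult_ac)
  finally show ?thesis .
qed

lemma integral_inner_square:
  assumes "\<mu> \<in> centered_P2"
  shows "(\<integral>x. (u \<bullet> x)\<^sup>2 \<partial>\<mu>) = u \<bullet> (second_moment \<mu> *v u)"
  using integral_inner_mult[OF assms, of u u] by (simp add: power2_eq_square)

lemma pca_objective_eq:
  assumes "\<mu> \<in> centered_P2"
  shows "pca_objective \<mu> u = 1/2 * (u \<bullet> (second_moment \<mu> *v u))"
  unfolding pca_objective_def integral_inner_square[OF assms, symmetric] by simp

lemma transpose_second_moment: "transpose (second_moment \<mu>) = second_moment \<mu>"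
  by (simp add: second_moment_def transpose_def vec_eq_iff mult.commute)

lemma second_moment_self_adjoint: "(second_moment \<mu> *v x) \<bullet> y = x \<bullet> (second_moment \<mu> *v y)"
  by (metis transpose_second_moment dot_lmul_matrix vector_transpose_matrix)

lemma second_moment_top_eigenpair:
  fixes \<mu> :: "(real^'n) measure"
  assumes \<mu>: "\<mu> \<in> centered_P2" and n: "CARD('n) \<ge> 2"
  defines "l1 \<equiv> ordered_eigenvalue 1 (second_moment \<mu>)" and "l2 \<equiv> ordered_eigenvalue 2 (second_moment \<mu>)"
  obtains e1 e2 where "norm e1 = 1" "norm e2 = 1" "e1 \<bullet> e2 = 0"
    "second_moment \<mu> *v e1 = l1 *\<^sub>R e1" "second_moment \<mu> *v e2 = l2 *\<^sub>R e2"
    "0 \<le> l2" "l2 \<le> l1" "top_eigenvalue ((*v) (second_moment \<mu>)) e1 l1 l2"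
proof -
  obtain e1 e2 where e: "norm e1 = 1" "norm e2 = 1" "e1 \<bullet> e2 = 0"
    "second_moment \<mu> *v e1 = l1 *\<^sub>R e1" "second_moment \<mu> *v e2 = l2 *\<^sub>R e2" "l2 \<le> l1"
    "\<And>w. e1 \<bullet> w = 0 \<Longrightarrow> w \<bullet> (second_moment \<mu> *v w) \<le> l2 * (norm w)\<^sup>2"
    unfolding l1_def l2_def
    using symmetric_matrix_top_eigenpair[OF transpose_second_moment n, of \<mu>] by blast
  have "0 \<le> (\<integral>x. (e2 \<bullet> x)\<^sup>2 \<partial>\<mu>)" by simp
  then have "0 \<le> l2" using e by (simp add: integral_inner_square[OF \<mu>] dot_square_norm)
  moreover have "top_eigenvalue ((*v) (second_moment \<mu>)) e1 l1 l2"
    using e by (intro top_eigenvalue.intro matrix_vector_mul_linear second_moment_self_adjoint) auto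
  ultimately show ?thesis using e that by blast
qed

text \<open>Comparing the objective at \<open>v\<close> and at \<open>e1\<close> forces
  \<open>(e1 \<bullet> v)^2 \<ge> 1\<close>, hence \<open>v = e1\<close> or \<open>v = - e1\<close>.
  Then \<open>v\<close> has the same eigenvalue and orthogonal complement as \<open>e1\<close>, and
  the local theory applies with \<open>v\<close> as base point.\<close>

lemma pca_regular_of_gap:
  fixes \<mu> :: "(real^'n) measure"
  assumes \<mu>: "\<mu> \<in> centered_P2" and n: "CARD('n) \<ge> 2"
    and gap: "ordered_eigenvalue 2 (second_moment \<mu>) < ordered_eigenvalue 1 (second_moment \<mu>)"
    and v: "v \<in> pca_maximizers \<mu>"
  shows "tilt_stable (sphere 0 1) (\<lambda>u. - pca_objective \<mu> u) v"
    and "pca_REG \<mu> v = ereal (1 / (ordered_eigenvalue 1 (second_moment \<mu>) - ordered_eigenvalue 2 (second_moment \<mu>)))"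
proof -
  define A where "A = second_moment \<mu>"
  define l1 where "l1 = ordered_eigenvalue 1 A"
  define l2 where "l2 = ordered_eigenvalue 2 A"
  obtain e1 e2 where e: "norm e1 = 1" "norm e2 = 1" "e1 \<bullet> e2 = 0"
    "A *v e1 = l1 *\<^sub>R e1" "A *v e2 = l2 *\<^sub>R e2" "0 \<le> l2" "l2 \<le> l1" "top_eigenvalue ((*v) A) e1 l1 l2"
    unfolding A_def l1_def l2_def using second_moment_top_eigenpair[OF \<mu> n] .
  interpret T: top_eigenvalue "(*v) A" e1 l1 l2 by fact
  have gap': "l2 < l1" using gap by (simp add: A_def l1_def l2_def)
  have nv: "norm v = 1" using v by (simp add: pca_maximizers_def maximizers_def)
  have "pca_objective \<mu> e1 \<le> pca_objective \<mu> v"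
    using v e(1) by (simp add: pca_maximizers_def maximizers_def)
  then have "l1 \<le> v \<bullet> (A *v v)"
    using e by (simp add: pca_objective_eq[OF \<mu>] A_def[symmetric] dot_square_norm)
  also have "\<dots> \<le> l2 + (l1 - l2) * (e1 \<bullet> v)\<^sup>2" using T.quadratic_form_le[of v] nv by simp
  finally have "(l1 - l2) * 1 \<le> (l1 - l2) * (e1 \<bullet> v)\<^sup>2" by simp
  then have c: "1 \<le> (e1 \<bullet> v)\<^sup>2" using gap' by (subst (asm) mult_le_cancel_left_pos) auto
  have "(norm (v - (e1 \<bullet> v) *\<^sub>R e1))\<^sup>2 = 1 - (e1 \<bullet> v)\<^sup>2"
    using nv e(1) unfolding power2_norm_eq_inner norm_eq_1
    by (simp add: inner_simps inner_commute power2_eq_square)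
  with c have "v = (e1 \<bullet> v) *\<^sub>R e1" by (smt (verit) zero_eq_power2 zero_le_power2 norm_eq_zero eq_iff_diff_eq_0)
  moreover from this have "\<bar>e1 \<bullet> v\<bar> = 1" using nv e(1) by (metis norm_scaleR mult.right_neutral)
  ultimately have "v = e1 \<or> v = - e1" by (metis abs_1 abs_eq_iff scaleR_minus1_left scaleR_one)
  then have ve: "A *v v = l1 *\<^sub>R v" "v \<bullet> e2 = 0" "v \<bullet> w = 0 \<longleftrightarrow> e1 \<bullet> w = 0" for w
    using e by (auto simp: linear_neg[OF T.lin])
  interpret V: simple_top_eigenvalue "(*v) A" v l1 l2
    by (intro simple_top_eigenvalue.intro top_eigenvalue.intro simple_top_eigenvalue_axioms.intro
        T.lin T.sym nv ve(1) gap' T.le) (simp add: ve(3))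
  have f: "(\<lambda>u. - pca_objective \<mu> u) = V.neg_rayleigh"
    by (simp add: pca_objective_eq[OF \<mu>] A_def fun_eq_iff)
  show "tilt_stable (sphere 0 1) (\<lambda>u. - pca_objective \<mu> u) v"
    unfolding f by (rule V.tilt_stable_top)
  show "pca_REG \<mu> v = ereal (1 / (ordered_eigenvalue 1 (second_moment \<mu>) - ordered_eigenvalue 2 (second_moment \<mu>)))"
    unfolding pca_REG_def f A_def[symmetric] l1_def[symmetric] l2_def[symmetric]
    using e ve(2) by (intro V.regularity_modulus_top)
qed

text \<open>The maximizers contain a whole circle, so none on it is isolated.\<close>

lemma pca_unstable_of_double_top:
  assumes \<mu>: "\<mu> \<in> centered_P2" and f: "norm f1 = 1" "norm f2 = 1" "f1 \<bullet> f2 = 0"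
    and le: "\<And>w. norm w = 1 \<Longrightarrow> pca_objective \<mu> w \<le> m"
    and eq: "\<And>a b. a\<^sup>2 + b\<^sup>2 = 1 \<Longrightarrow> pca_objective \<mu> (a *\<^sub>R f1 + b *\<^sub>R f2) = m"
  shows "\<mu> \<in> pca_unstable"
proof -
  have ff: "f1 \<bullet> f1 = 1" "f2 \<bullet> f2 = 1" "f2 \<bullet> f1 = 0" using f by (simp_all add: dot_square_norm inner_commute)
  have f1: "pca_objective \<mu> f1 = m" using eq[of 1 0] by simp
  then have "f1 \<in> pca_maximizers \<mu>"
    using f le by (simp add: pca_maximizers_def maximizers_def)
  moreover have "\<not> tilt_stable (sphere 0 1) (\<lambda>u. - pca_objective \<mu> u) f1"
  proof
    assume "tilt_stable (sphere 0 1) (\<lambda>u. - pca_objective \<mu> u) f1"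
    then obtain \<epsilon> where \<epsilon>: "0 < \<epsilon>"
      and arg: "tilt_argmin (sphere 0 1) (\<lambda>u. - pca_objective \<mu> u) f1 \<epsilon> 0 = {f1}"
      by (auto simp: tilt_stable_def tilt_radius_def)
    define u where "u t = cos t *\<^sub>R f1 + sin t *\<^sub>R f2" for t
    have "((\<lambda>t. dist f1 (u t)) \<longlongrightarrow> dist f1 (cos 0 *\<^sub>R f1 + sin 0 *\<^sub>R f2)) (at_right 0)"
      unfolding u_def by (intro tendsto_intros)
    then have "eventually (\<lambda>t. dist f1 (u t) < \<epsilon>) (at_right 0)"
      using \<epsilon> by (auto dest: order_tendstoD)
    \<comment> \<open>On this interval the sine, which is the \<open>f2\<close> component of
      \<open>u t\<close>, is positive; this separates \<open>u t\<close> from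
      \<open>f1\<close>.\<close>
    moreover have "eventually (\<lambda>t. t \<in> {0<..<pi}) (at_right (0::real))"
      by (rule eventually_at_right_real) simp
    ultimately have "eventually (\<lambda>t. dist f1 (u t) < \<epsilon> \<and> t \<in> {0<..<pi}) (at_right 0)"
      by (rule eventually_conj)
    then obtain t where t: "dist f1 (u t) < \<epsilon>" "0 < t" "t < pi"
      by (auto dest!: eventually_happens)
    have "u t \<bullet> u t = (cos t)\<^sup>2 + (sin t)\<^sup>2"
      using ff f unfolding u_def by (simp add: inner_simps power2_eq_square)
    then have "norm (u t) = 1" by (simp add: norm_eq_1)
    moreover have "pca_objective \<mu> (u t) = m" unfolding u_def by (rule eq) simp
    ultimately have "u t \<in> tilt_argmin (sphere 0 1) (\<lambda>u. - pca_objective \<mu> u) f1 \<epsilon> 0"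
      using t le by (simp add: tilt_argmin_def minimizers_def)
    then have "u t = f1" using arg by simp
    moreover have "u t \<bullet> f2 = sin t" using ff f by (simp add: u_def inner_simps)
    ultimately have "sin t = 0" using f by simp
    then show False using t sin_gt_zero by force
  qed
  ultimately show ?thesis using \<mu> by (auto simp: pca_unstable_def)
qed

lemma pca_unstable_iff:
  fixes \<mu> :: "(real^'n) measure"
  assumes \<mu>: "\<mu> \<in> centered_P2" and n: "CARD('n) \<ge> 2"
  shows "\<mu> \<in> pca_unstable \<longleftrightarrow>
    ordered_eigenvalue 1 (second_moment \<mu>) = ordered_eigenvalue 2 (second_moment \<mu>)"
proof -
  define A where "A = second_moment \<mu>"
  define l1 where "l1 = ordered_eigenvalue 1 A"
  define l2 where "l2 = ordered_eigenvalue 2 A"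
  obtain e1 e2 where e: "norm e1 = 1" "norm e2 = 1" "e1 \<bullet> e2 = 0"
    "A *v e1 = l1 *\<^sub>R e1" "A *v e2 = l2 *\<^sub>R e2" "0 \<le> l2" "l2 \<le> l1" "top_eigenvalue ((*v) A) e1 l1 l2"
    unfolding A_def l1_def l2_def using second_moment_top_eigenpair[OF \<mu> n] .
  interpret T: top_eigenvalue "(*v) A" e1 l1 l2 by fact
  show ?thesis
    unfolding A_def[symmetric] l1_def[symmetric] l2_def[symmetric]
  proof
    assume "\<mu> \<in> pca_unstable"
    then have "\<not> l2 < l1"
      unfolding l1_def l2_def A_def using pca_regular_of_gap(1)[OF \<mu> n] by (auto simp: pca_unstable_def)
    then show "l1 = l2" using e by simp
  next
    assume l: "l1 = l2"
    show "\<mu> \<in> pca_unstable"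
    proof (rule pca_unstable_of_double_top[OF \<mu> e(1-3), of "l1 / 2"])
      show "pca_objective \<mu> w \<le> l1 / 2" if "norm w = 1" for w
        using T.quadratic_form_le[of w] l that by (simp add: pca_objective_eq[OF \<mu>] A_def[symmetric])
      show "pca_objective \<mu> (a *\<^sub>R e1 + b *\<^sub>R e2) = l1 / 2" if "a\<^sup>2 + b\<^sup>2 = 1" for a b
      proof -
        have "A *v (a *\<^sub>R e1 + b *\<^sub>R e2) = l1 *\<^sub>R (a *\<^sub>R e1 + b *\<^sub>R e2)"
          using e l by (simp add: matrix_vector_right_distrib matrix_vector_mult_scaleR scaleR_add_right mult.commute)
        moreover have "(a *\<^sub>R e1 + b *\<^sub>R e2) \<bullet> (a *\<^sub>R e1 + b *\<^sub>R e2) = a\<^sup>2 + b\<^sup>2"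
          using e by (simp add: norm_eq_1 inner_simps inner_commute power2_eq_square)
        ultimately show ?thesis
          using that by (simp only: pca_objective_eq[OF \<mu>] A_def[symmetric] inner_scaleR_right)
      qed
    qed
  qed
qed

section \<open>Distance to the unstable measures\<close>

lemma L2_reverse_triangle:
  fixes X Y :: "'a \<Rightarrow> real"
  assumes X: "integrable M (\<lambda>x. (X x)\<^sup>2)" and Y: "integrable M (\<lambda>x. (Y x)\<^sup>2)"
    and XY: "integrable M (\<lambda>x. X x * Y x)"
  shows "(sqrt (\<integral>x. (X x)\<^sup>2 \<partial>M) - sqrt (\<integral>x. (Y x)\<^sup>2 \<partial>M))\<^sup>2 \<le> (\<integral>x. (X x - Y x)\<^sup>2 \<partial>M)"
proof -
  define a where "a = sqrt (\<integral>x. (X x)\<^sup>2 \<partial>M)"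
  define b where "b = sqrt (\<integral>x. (Y x)\<^sup>2 \<partial>M)"
  define c where "c = (\<integral>x. X x * Y x \<partial>M)"
  have ab: "0 \<le> a" "0 \<le> b" by (auto simp: a_def b_def)
  have a2: "(\<integral>x. (X x)\<^sup>2 \<partial>M) = a\<^sup>2" and b2: "(\<integral>x. (Y x)\<^sup>2 \<partial>M) = b\<^sup>2"
    by (auto simp: a_def b_def)
  have quad: "(\<integral>x. (s * X x - t * Y x)\<^sup>2 \<partial>M) = s\<^sup>2 * a\<^sup>2 - 2 * s * t * c + t\<^sup>2 * b\<^sup>2" for s t
  proof -
    have "(\<integral>x. (s * X x - t * Y x)\<^sup>2 \<partial>M)
        = (\<integral>x. s\<^sup>2 * (X x)\<^sup>2 - (2 * s * t) * (X x * Y x) + t\<^sup>2 * (Y x)\<^sup>2 \<partial>M)"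
      by (intro Bochner_Integration.integral_cong) (auto simp: power2_eq_square algebra_simps)
    also have "\<dots> = s\<^sup>2 * (\<integral>x. (X x)\<^sup>2 \<partial>M) - (2 * s * t) * c + t\<^sup>2 * (\<integral>x. (Y x)\<^sup>2 \<partial>M)"
      using X Y XY unfolding c_def by simp
    finally show ?thesis by (simp add: a2 b2)
  qed
  have pos: "0 \<le> s\<^sup>2 * a\<^sup>2 - 2 * s * t * c + t\<^sup>2 * b\<^sup>2" for s t
    unfolding quad[symmetric] by simp
  \<comment> \<open>Cauchy-Schwarz. The choice \<open>s = b\<close>, \<open>t = a\<close> in
    \<open>pos\<close> says nothing if one of the norms is 0; then one square drops out of
    \<open>pos\<close>, and fixing the variable that went with it at 1 leaves a quadratic without
    constant term, so \<open>c = 0\<close>.\<close>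
  have "c \<le> a * b"
  proof (cases "a = 0 \<or> b = 0")
    case True
    have "- 2 * c = 0"
    proof (cases "a = 0")
      case True
      show ?thesis using pos[of 1] True by (intro linear_coeff_zero_of_nonneg_quadratic[of _ "b\<^sup>2"]) (simp add: algebra_simps)
    next
      case False
      with \<open>a = 0 \<or> b = 0\<close> show ?thesis
        using pos[of _ 1] by (intro linear_coeff_zero_of_nonneg_quadratic[of _ "a\<^sup>2"]) (simp add: algebra_simps)
    qed
    then show ?thesis using True by auto
  next
    case False
    then have "0 < 2 * (a * b)" using ab by simp
    moreover have "0 \<le> 2 * (a * b) * (a * b - c)"
      using pos[of b a] by (simp add: power2_eq_square algebra_simps)
    ultimately show ?thesis by (simp add: zero_le_mult_iff)
  qed
  moreover have "(\<integral>x. (X x - Y x)\<^sup>2 \<partial>M) = a\<^sup>2 - 2 * c + b\<^sup>2" using quad[of 1 1] by simp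
  ultimately show ?thesis
    unfolding a_def[symmetric] b_def[symmetric] by (simp add: power2_diff)
qed

text \<open>The real infimum in \<open>W2\<close> can be bounded from below only over a nonempty
  set; the product coupling provides this.\<close>

lemma pair_measure_in_couplings:
  fixes \<mu> \<nu> :: "'a::euclidean_space measure"
  assumes "sets \<mu> = sets borel" "prob_space \<mu>" "sets \<nu> = sets borel" "prob_space \<nu>"
  shows "\<mu> \<Otimes>\<^sub>M \<nu> \<in> couplings \<mu> \<nu>"
proof -
  interpret \<mu>: prob_space \<mu> by fact
  interpret \<nu>: prob_space \<nu> by fact
  interpret pair_prob_space \<mu> \<nu> ..
  have s: "sets (\<mu> \<Otimes>\<^sub>M \<nu>) = sets borel"
    using sets_pair_measure_cong[OF assms(1,3)] by (simp only: borel_prod)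
  have fst: "distr (\<mu> \<Otimes>\<^sub>M \<nu>) borel fst = \<mu>"
    using \<nu>.distr_pair_fst[of \<mu>] assms(1) by (metis distr_cong)
  have snd: "distr (\<mu> \<Otimes>\<^sub>M \<nu>) borel snd = \<nu>"
  proof (rule measure_eqI)
    show "sets (distr (\<mu> \<Otimes>\<^sub>M \<nu>) borel snd) = sets \<nu>" using assms by simp
    fix A assume "A \<in> sets (distr (\<mu> \<Otimes>\<^sub>M \<nu>) borel snd)"
    then have A: "A \<in> sets borel" "A \<in> sets \<nu>" using assms by auto
    have "snd \<in> measurable (\<mu> \<Otimes>\<^sub>M \<nu>) borel"
      using measurable_snd[of \<mu> \<nu>] assms(3) by (simp cong: measurable_cong_sets)
    then have "emeasure (distr (\<mu> \<Otimes>\<^sub>M \<nu>) borel snd) A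
        = emeasure (\<mu> \<Otimes>\<^sub>M \<nu>) (snd -` A \<inter> space (\<mu> \<Otimes>\<^sub>M \<nu>))"
      using A by (simp add: emeasure_distr)
    also have "snd -` A \<inter> space (\<mu> \<Otimes>\<^sub>M \<nu>) = space \<mu> \<times> A"
      using sets.sets_into_space[OF A(2)] by (auto simp: space_pair_measure)
    also have "emeasure (\<mu> \<Otimes>\<^sub>M \<nu>) (space \<mu> \<times> A) = emeasure \<nu> A"
      using A by (simp add: \<nu>.emeasure_pair_measure_Times \<mu>.emeasure_space_1)
    finally show "emeasure (distr (\<mu> \<Otimes>\<^sub>M \<nu>) borel snd) A = emeasure \<nu> A" .
  qed
  show ?thesis using s fst snd by (simp add: couplings_def prob_space_axioms)
qed

lemma W2_le:
  assumes "\<pi> \<in> couplings \<mu> \<nu>"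
  shows "W2 \<mu> \<nu> \<le> sqrt (\<integral>(x, y). (norm (x - y))\<^sup>2 \<partial>\<pi>)"
  unfolding W2_def
proof (rule cINF_lower[OF _ assms])
  have "0 \<le> sqrt (\<integral>(x, y). (norm (x - y))\<^sup>2 \<partial>\<pi>)" for \<pi> :: "('a \<times> 'a) measure"
    by (auto intro!: Bochner_Integration.integral_nonneg)
  then show "bdd_below ((\<lambda>\<pi>. sqrt (\<integral>(x, y). (norm (x - y))\<^sup>2 \<partial>\<pi>)) ` couplings \<mu> \<nu>)"
    by (intro bdd_belowI2[of _ 0])
qed

text \<open>Bessel's inequality reduces the cost to two directions, and in each the reverse triangle
  inequality in L2 leaves deviations that depend only on the marginals.\<close>

lemma coupling_cost_lower_bound:
  fixes \<mu> \<nu> :: "(real^'n) measure"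
  assumes \<mu>: "\<mu> \<in> centered_P2" and \<nu>: "\<nu> \<in> centered_P2" and \<pi>: "\<pi> \<in> couplings \<mu> \<nu>"
    and f: "norm f1 = 1" "norm f2 = 1" "f1 \<bullet> f2 = 0"
  shows "(sqrt (\<integral>x. (f1 \<bullet> x)\<^sup>2 \<partial>\<mu>) - sqrt (\<integral>x. (f1 \<bullet> x)\<^sup>2 \<partial>\<nu>))\<^sup>2
       + (sqrt (\<integral>x. (f2 \<bullet> x)\<^sup>2 \<partial>\<mu>) - sqrt (\<integral>x. (f2 \<bullet> x)\<^sup>2 \<partial>\<nu>))\<^sup>2
       \<le> (\<integral>(x, y). (norm (x - y))\<^sup>2 \<partial>\<pi>)"
proof -
  have sets: "sets \<pi> = sets borel" and d: "distr \<pi> borel fst = \<mu>" "distr \<pi> borel snd = \<nu>"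
    using \<pi> by (auto simp: couplings_def)
  have meas: "h \<in> borel_measurable \<pi>" if "continuous_on UNIV h" for h :: "_ \<Rightarrow> 'b::topological_space"
    using borel_measurable_continuous_onI[OF that] sets by (simp cong: measurable_cong_sets)
  have pm: "fst \<in> measurable \<pi> borel" "snd \<in> measurable \<pi> borel"
    by (intro meas continuous_intros)+
  have fst: "integrable \<pi> (\<lambda>z. h (fst z)) = integrable \<mu> h" "(\<integral>z. h (fst z) \<partial>\<pi>) = integral\<^sup>L \<mu> h"
    and snd: "integrable \<pi> (\<lambda>z. h (snd z)) = integrable \<nu> h" "(\<integral>z. h (snd z) \<partial>\<pi>) = integral\<^sup>L \<nu> h"
    if "h \<in> borel_measurable borel" for h :: "_ \<Rightarrow> real"
    unfolding d[symmetric] using that pm by (simp_all add: integrable_distr_eq integral_distr)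
  have bm: "(\<lambda>x. (f \<bullet> x)\<^sup>2) \<in> borel_measurable borel" "(\<lambda>x. (norm x)\<^sup>2) \<in> borel_measurable borel"
    for f :: "real^'n" by measurable
  have N: "integrable \<pi> (\<lambda>z. (norm (fst z))\<^sup>2)" "integrable \<pi> (\<lambda>z. (norm (snd z))\<^sup>2)"
    using \<mu> \<nu> by (simp_all add: fst(1)[OF bm(2)] snd(1)[OF bm(2)] centered_P2_def)
  \<comment> \<open>A nonintegrable cost would have integral 0 by convention and break the
    comparison below; the second moments of the marginals exclude this.\<close>
  have cost: "integrable \<pi> (\<lambda>z. (norm (fst z - snd z))\<^sup>2)"
  proof (rule Bochner_Integration.integrable_bound)
    show "integrable \<pi> (\<lambda>z. 2 * (norm (fst z))\<^sup>2 + 2 * (norm (snd z))\<^sup>2)" using N by simp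
    show "(\<lambda>z. (norm (fst z - snd z))\<^sup>2) \<in> borel_measurable \<pi>" by (intro meas continuous_intros)
    have "(norm (x - y))\<^sup>2 \<le> 2 * (norm x)\<^sup>2 + 2 * (norm y)\<^sup>2" for x y :: "real^'n"
      using zero_le_power2[of "norm (x + y)"] unfolding power2_norm_eq_inner
      by (simp add: inner_simps inner_commute)
    then show "AE z in \<pi>. norm ((norm (fst z - snd z))\<^sup>2) \<le> norm (2 * (norm (fst z))\<^sup>2 + 2 * (norm (snd z))\<^sup>2)"
      by simp
  qed
  have dir: "integrable \<pi> (\<lambda>z. (f \<bullet> (fst z - snd z))\<^sup>2) \<and>
      (sqrt (\<integral>x. (f \<bullet> x)\<^sup>2 \<partial>\<mu>) - sqrt (\<integral>x. (f \<bullet> x)\<^sup>2 \<partial>\<nu>))\<^sup>2 \<le> (\<integral>z. (f \<bullet> (fst z - snd z))\<^sup>2 \<partial>\<pi>)" for f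
  proof
    have X: "integrable \<pi> (\<lambda>z. (f \<bullet> fst z)\<^sup>2)" and Y: "integrable \<pi> (\<lambda>z. (f \<bullet> snd z)\<^sup>2)"
      using \<mu> \<nu> by (simp_all add: fst(1)[OF bm(1)] snd(1)[OF bm(1)] integrable_inner_square_P2)
    have XY: "integrable \<pi> (\<lambda>z. (f \<bullet> fst z) * (f \<bullet> snd z))"
    proof (rule Bochner_Integration.integrable_bound)
      show "integrable \<pi> (\<lambda>z. (f \<bullet> fst z)\<^sup>2 + (f \<bullet> snd z)\<^sup>2)" using X Y by simp
      show "(\<lambda>z. (f \<bullet> fst z) * (f \<bullet> snd z)) \<in> borel_measurable \<pi>" by (intro meas continuous_intros)
      have "\<bar>a * b\<bar> \<le> \<bar>a\<^sup>2 + b\<^sup>2\<bar>" for a b :: real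
      proof -
        have "0 \<le> (\<bar>a\<bar> - \<bar>b\<bar>)\<^sup>2" by simp
        then have "2 * (\<bar>a\<bar> * \<bar>b\<bar>) \<le> a\<^sup>2 + b\<^sup>2" by (simp add: power2_diff)
        moreover have "0 \<le> \<bar>a\<bar> * \<bar>b\<bar>" by simp
        ultimately show ?thesis unfolding abs_mult by linarith
      qed
      then show "AE z in \<pi>. norm ((f \<bullet> fst z) * (f \<bullet> snd z)) \<le> norm ((f \<bullet> fst z)\<^sup>2 + (f \<bullet> snd z)\<^sup>2)"
        by simp
    qed
    show "(sqrt (\<integral>x. (f \<bullet> x)\<^sup>2 \<partial>\<mu>) - sqrt (\<integral>x. (f \<bullet> x)\<^sup>2 \<partial>\<nu>))\<^sup>2 \<le> (\<integral>z. (f \<bullet> (fst z - snd z))\<^sup>2 \<partial>\<pi>)"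
      using L2_reverse_triangle[OF X Y XY] by (simp add: fst(2)[OF bm(1)] snd(2)[OF bm(1)] inner_diff_right)
    have "integrable \<pi> (\<lambda>z. (f \<bullet> fst z)\<^sup>2 + (f \<bullet> snd z)\<^sup>2 - 2 * ((f \<bullet> fst z) * (f \<bullet> snd z)))"
      using X Y XY by simp
    then show "integrable \<pi> (\<lambda>z. (f \<bullet> (fst z - snd z))\<^sup>2)"
      by (simp add: inner_diff_right power2_diff mult.assoc)
  qed
  have bessel: "(f1 \<bullet> z)\<^sup>2 + (f2 \<bullet> z)\<^sup>2 \<le> (norm z)\<^sup>2" for z
  proof -
    have "0 \<le> (norm (z - (f1 \<bullet> z) *\<^sub>R f1 - (f2 \<bullet> z) *\<^sub>R f2))\<^sup>2" by simp
    also have "\<dots> = (norm z)\<^sup>2 - (f1 \<bullet> z)\<^sup>2 - (f2 \<bullet> z)\<^sup>2"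
      using f unfolding power2_norm_eq_inner norm_eq_1
      by (simp add: inner_simps inner_commute power2_eq_square)
    finally show ?thesis by simp
  qed
  have "(sqrt (\<integral>x. (f1 \<bullet> x)\<^sup>2 \<partial>\<mu>) - sqrt (\<integral>x. (f1 \<bullet> x)\<^sup>2 \<partial>\<nu>))\<^sup>2
       + (sqrt (\<integral>x. (f2 \<bullet> x)\<^sup>2 \<partial>\<mu>) - sqrt (\<integral>x. (f2 \<bullet> x)\<^sup>2 \<partial>\<nu>))\<^sup>2
       \<le> (\<integral>z. (f1 \<bullet> (fst z - snd z))\<^sup>2 \<partial>\<pi>) + (\<integral>z. (f2 \<bullet> (fst z - snd z))\<^sup>2 \<partial>\<pi>)"
    using dir by (intro add_mono) auto
  also have "\<dots> = (\<integral>z. (f1 \<bullet> (fst z - snd z))\<^sup>2 + (f2 \<bullet> (fst z - snd z))\<^sup>2 \<partial>\<pi>)"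
    using dir by (intro Bochner_Integration.integral_add[symmetric]) auto
  also have "\<dots> \<le> (\<integral>z. (norm (fst z - snd z))\<^sup>2 \<partial>\<pi>)"
    using dir cost bessel by (intro integral_mono Bochner_Integration.integrable_add) auto
  also have "\<dots> = (\<integral>(x, y). (norm (x - y))\<^sup>2 \<partial>\<pi>)"
    by (simp add: case_prod_unfold)
  finally show ?thesis .
qed

text \<open>A plane on which \<open>\<nu>\<close> has its maximal deviation \<open>s\<close> in every direction contains a unit vector
  \<open>g\<close> orthogonal to the top eigenvector \<open>e\<^sub>1\<close> of \<open>\<mu>\<close>. Along \<open>e\<^sub>1\<close> the deviation of \<open>\<nu>\<close> is at most
  \<open>s\<close> and along \<open>g\<close> it equals \<open>s\<close>, while for \<open>\<mu>\<close> they are \<open>\<surd>\<lambda>\<^sub>1\<close> and at most \<open>\<surd>\<lambda>\<^sub>2\<close>.\<close>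

lemma W2_unstable_lower_bound:
  fixes \<mu> \<nu> :: "(real^'n) measure"
  assumes n: "CARD('n) \<ge> 2" and \<mu>: "\<mu> \<in> centered_P2" and \<nu>: "\<nu> \<in> pca_unstable"
  shows "(sqrt (ordered_eigenvalue 1 (second_moment \<mu>)) - sqrt (ordered_eigenvalue 2 (second_moment \<mu>))) / sqrt 2
    \<le> W2 \<mu> \<nu>"
proof -
  define A where "A = second_moment \<mu>"
  define l1 where "l1 = ordered_eigenvalue 1 A"
  define l2 where "l2 = ordered_eigenvalue 2 A"
  obtain e1 e2 where e: "norm e1 = 1" "norm e2 = 1" "e1 \<bullet> e2 = 0"
    "A *v e1 = l1 *\<^sub>R e1" "A *v e2 = l2 *\<^sub>R e2" "0 \<le> l2" "l2 \<le> l1" "top_eigenvalue ((*v) A) e1 l1 l2"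
    unfolding A_def l1_def l2_def using second_moment_top_eigenpair[OF \<mu> n] .
  interpret T: top_eigenvalue "(*v) A" e1 l1 l2 by fact
  have \<nu>': "\<nu> \<in> centered_P2" using \<nu> by (simp add: pca_unstable_def)
  define B where "B = second_moment \<nu>"
  define m where "m = ordered_eigenvalue 1 B"
  have m2: "ordered_eigenvalue 2 B = m" using \<nu> pca_unstable_iff[OF \<nu>' n] by (simp add: B_def m_def)
  obtain f1 f2 where f: "norm f1 = 1" "norm f2 = 1" "f1 \<bullet> f2 = 0"
    "B *v f1 = m *\<^sub>R f1" "B *v f2 = m *\<^sub>R f2" "0 \<le> m" "top_eigenvalue ((*v) B) f1 m m"
    using second_moment_top_eigenpair[OF \<nu>' n, folded B_def, unfolded m2, folded m_def] by blast
  interpret S: top_eigenvalue "(*v) B" f1 m m by fact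
  obtain g where g: "norm g = 1" "e1 \<bullet> g = 0" "B *v g = m *\<^sub>R g"
  proof (cases "e1 \<bullet> f1 = 0")
    case True
    then show ?thesis using f that by blast
  next
    case False
    \<comment> \<open>The combination of \<open>f1\<close> and \<open>f2\<close> that is orthogonal
      to \<open>e1\<close>; it stays in the eigenspace of \<open>m\<close>.\<close>
    define h where "h = (e1 \<bullet> f2) *\<^sub>R f1 - (e1 \<bullet> f1) *\<^sub>R f2"
    have "h \<bullet> f2 = - (e1 \<bullet> f1)" using f by (simp add: h_def inner_simps norm_eq_1)
    then have "h \<noteq> 0" using False by auto
    then have "norm ((1 / norm h) *\<^sub>R h) = 1" by simp
    moreover have "e1 \<bullet> ((1 / norm h) *\<^sub>R h) = 0" by (simp add: h_def inner_simps)
    moreover have "B *v h = m *\<^sub>R h"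
      using f by (simp add: h_def matrix_vector_mult_diff_distrib matrix_vector_mult_scaleR
          scaleR_diff_right mult.commute)
    then have "B *v ((1 / norm h) *\<^sub>R h) = m *\<^sub>R ((1 / norm h) *\<^sub>R h)"
      by (simp add: matrix_vector_mult_scaleR)
    ultimately show ?thesis by (rule that)
  qed
  have "(sqrt l1 - sqrt l2) / sqrt 2 \<le> sqrt (\<integral>(x, y). (norm (x - y))\<^sup>2 \<partial>\<pi>)"
    if \<pi>: "\<pi> \<in> couplings \<mu> \<nu>" for \<pi>
  proof -
    define s where "s = sqrt m"
    define p where "p = sqrt (\<integral>x. (e1 \<bullet> x)\<^sup>2 \<partial>\<nu>)"
    define q where "q = sqrt (\<integral>x. (g \<bullet> x)\<^sup>2 \<partial>\<mu>)"
    have "(\<integral>x. (e1 \<bullet> x)\<^sup>2 \<partial>\<mu>) = l1"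
      using e by (simp add: integral_inner_square[OF \<mu>] A_def[symmetric] dot_square_norm)
    moreover have "(\<integral>x. (g \<bullet> x)\<^sup>2 \<partial>\<nu>) = m"
      using g by (simp add: integral_inner_square[OF \<nu>'] B_def[symmetric] dot_square_norm)
    ultimately have cost: "(sqrt l1 - p)\<^sup>2 + (q - s)\<^sup>2 \<le> (\<integral>(x, y). (norm (x - y))\<^sup>2 \<partial>\<pi>)"
      using coupling_cost_lower_bound[OF \<mu> \<nu>' \<pi> e(1) g(1,2)] by (simp add: p_def q_def s_def)
    have "p \<le> s"
      unfolding p_def s_def integral_inner_square[OF \<nu>'] B_def[symmetric]
      using S.quadratic_form_le[of e1] e by simp
    moreover have "q \<le> sqrt l2"
      unfolding q_def integral_inner_square[OF \<mu>] A_def[symmetric]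
      using T.le[of g] g by simp
    \<comment> \<open>Positive parts, because \<open>s\<close> may lie outside the interval from
      \<open>sqrt l2\<close> to \<open>sqrt l1\<close>. Their sum always covers the length of that
      interval, and \<open>(a + b)^2 / 2 \<le> a^2 + b^2\<close> then produces the factor 1 / sqrt
      2.\<close>
    moreover define a where "a = max 0 (sqrt l1 - s)"
    moreover define b where "b = max 0 (s - sqrt l2)"
    ultimately have ab: "0 \<le> a" "0 \<le> b" "a \<le> \<bar>sqrt l1 - p\<bar>" "b \<le> \<bar>q - s\<bar>" "sqrt l1 - sqrt l2 \<le> a + b"
      by auto
    have "((sqrt l1 - sqrt l2) / sqrt 2)\<^sup>2 \<le> ((a + b) / sqrt 2)\<^sup>2"
      using ab e by (intro power_mono divide_right_mono) auto
    also have "\<dots> \<le> a\<^sup>2 + b\<^sup>2"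
      using zero_le_power2[of "a - b"] by (simp add: power_divide power2_diff power2_sum)
    also have "\<dots> \<le> (sqrt l1 - p)\<^sup>2 + (q - s)\<^sup>2"
      using ab by (intro add_mono) (auto simp: abs_le_square_iff[symmetric])
    also note cost
    finally show ?thesis by (rule real_le_rsqrt)
  qed
  then show ?thesis
    unfolding W2_def l1_def[symmetric] l2_def[symmetric] A_def[symmetric]
    using pair_measure_in_couplings[of \<mu> \<nu>] \<mu> \<nu>' by (intro cINF_greatest) (auto simp: centered_P2_def)
qed

section \<open>A nearest unstable measure\<close>

lemma integrable_norm_bounded_linear_P2:
  fixes R :: "real^'n \<Rightarrow> 'b::{real_normed_vector, second_countable_topology}"
  assumes \<mu>: "\<mu> \<in> centered_P2" and R: "bounded_linear R"
  shows "integrable \<mu> (\<lambda>x. (norm (R x))\<^sup>2)"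
proof -
  obtain K where K: "\<And>x. norm (R x) \<le> norm x * K"
    using bounded_linear.bounded[OF R] by blast
  have m: "(\<lambda>x. (norm (R x))\<^sup>2) \<in> borel_measurable borel"
    by (intro borel_measurable_continuous_onI continuous_intros linear_continuous_on R)
  show ?thesis
  proof (rule Bochner_Integration.integrable_bound)
    show "integrable \<mu> (\<lambda>x. K\<^sup>2 * (norm x)\<^sup>2)" using \<mu> by (simp add: centered_P2_def)
    show "(\<lambda>x. (norm (R x))\<^sup>2) \<in> borel_measurable \<mu>"
      using m \<mu> by (simp add: centered_P2_def cong: measurable_cong_sets)
    have "(norm (R x))\<^sup>2 \<le> K\<^sup>2 * (norm x)\<^sup>2" for x
      using power_mono[OF K[of x], of 2] by (simp add: power_mult_distrib mult.commute)
    then show "AE x in \<mu>. norm ((norm (R x))\<^sup>2) \<le> norm (K\<^sup>2 * (norm x)\<^sup>2)" by simp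
  qed
qed

lemma integrable_id_P2:
  fixes \<mu> :: "(real^'n) measure"
  assumes \<mu>: "\<mu> \<in> centered_P2"
  shows "integrable \<mu> (\<lambda>x. x)"
proof -
  interpret prob_space \<mu> using \<mu> by (simp add: centered_P2_def)
  show ?thesis
  proof (rule Bochner_Integration.integrable_bound)
    show "integrable \<mu> (\<lambda>x. 1 + (norm x)\<^sup>2)" using \<mu> by (simp add: centered_P2_def)
    have "(\<lambda>x. x) \<in> borel_measurable (borel :: (real^'n) measure)" by simp
    then show "(\<lambda>x. x) \<in> borel_measurable \<mu>" using \<mu> by (simp add: centered_P2_def cong: measurable_cong_sets)
    have "norm x \<le> 1 + (norm x)\<^sup>2" for x :: "real^'n"
    proof -
      have "0 \<le> (norm x)\<^sup>2 - 2 * norm x + 1"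
        using zero_le_power2[of "norm x - 1"] by (simp add: power2_diff)
      then show ?thesis using norm_ge_zero[of x] by linarith
    qed
    then show "AE x in \<mu>. norm x \<le> norm (1 + (norm x)\<^sup>2)" by simp
  qed
qed

text \<open>A fair coin, independent of \<open>x\<close>, decides between \<open>S x\<close> and
  \<open>T x\<close>; \<open>\<pi>\<close> is the joint law of \<open>x\<close> and the result.
  Mixed terms of opposite sign in \<open>S\<close> and \<open>T\<close> average out in the second
  moments of \<open>\<nu>\<close>, which allows an uncorrelated component to be created.\<close>

lemma coin_mixture_coupling:
  fixes \<mu> :: "(real^'n) measure"
  assumes \<mu>: "\<mu> \<in> centered_P2" and S: "bounded_linear S" and T: "bounded_linear T"
  obtains \<nu> \<pi> where "\<nu> \<in> centered_P2" "\<pi> \<in> couplings \<mu> \<nu>"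
    "\<And>w. (\<integral>y. (w \<bullet> y)\<^sup>2 \<partial>\<nu>) = ((\<integral>x. (w \<bullet> S x)\<^sup>2 \<partial>\<mu>) + (\<integral>x. (w \<bullet> T x)\<^sup>2 \<partial>\<mu>)) / 2"
    "(\<integral>(x, y). (norm (x - y))\<^sup>2 \<partial>\<pi>) = ((\<integral>x. (norm (x - S x))\<^sup>2 \<partial>\<mu>) + (\<integral>x. (norm (x - T x))\<^sup>2 \<partial>\<mu>)) / 2"
proof -
  define C where "C = measure_pmf (bernoulli_pmf (1/2))"
  define P where "P = \<mu> \<Otimes>\<^sub>M C"
  interpret \<mu>: prob_space \<mu> using \<mu> by (simp add: centered_P2_def)
  interpret C: prob_space C unfolding C_def by (rule prob_space_measure_pmf)
  interpret pair_prob_space \<mu> C ..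
  have [measurable_cong]: "sets \<mu> = sets borel" using \<mu> by (simp add: centered_P2_def)
  have [measurable_cong]: "sets C = sets (count_space UNIV)" by (simp add: C_def)
  have [measurable]: "S \<in> borel_measurable borel" "T \<in> borel_measurable borel"
    using S T by (auto intro!: borel_measurable_continuous_onI linear_continuous_on)
  define Y where "Y z = (if snd z then S (fst z) else T (fst z))" for z
  have Y[measurable]: "Y \<in> measurable P borel" unfolding Y_def[abs_def] P_def by measurable
  have fst[measurable]: "fst \<in> measurable P borel" unfolding P_def by measurable
  define \<phi> where "\<phi> z = (fst z, Y z)" for z
  have \<phi>: "\<phi> \<in> measurable P borel"
    unfolding \<phi>_def[abs_def] borel_prod[symmetric] by measurable
  define \<pi> where "\<pi> = distr P borel \<phi>"
  define \<nu> where "\<nu> = distr P borel Y"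
  have P: "prob_space P" unfolding P_def by (rule prob_space_axioms)
  have avg: "integrable P f \<and> integral\<^sup>L P f = (1/2) *\<^sub>R (\<integral>x. f (x, True) \<partial>\<mu>) + (1/2) *\<^sub>R (\<integral>x. f (x, False) \<partial>\<mu>)"
    if f: "f \<in> borel_measurable P" "integrable \<mu> (\<lambda>x. f (x, True))" "integrable \<mu> (\<lambda>x. f (x, False))"
    for f :: "_ \<Rightarrow> 'b::{banach, second_countable_topology}"
  proof -
    have C: "integrable C g" "(\<integral>y. g y \<partial>C) = (1/2) *\<^sub>R g True + (1/2) *\<^sub>R g False"
      for g :: "bool \<Rightarrow> 'c::{banach, second_countable_topology}"
      unfolding C_def
      by (rule integrable_measure_pmf_finite, simp)
        (subst integral_measure_pmf[of UNIV], auto simp: UNIV_bool add.commute)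
    have int: "integrable P f"
      unfolding P_def
    proof (rule Fubini_integrable)
      show "f \<in> borel_measurable (\<mu> \<Otimes>\<^sub>M C)" using f(1) by (simp add: P_def)
      show "integrable \<mu> (\<lambda>x. \<integral>y. norm (f (x, y)) \<partial>C)" using f by (simp add: C(2))
    qed (simp add: C(1))
    moreover have "integral\<^sup>L P f = (\<integral>x. (\<integral>y. f (x, y) \<partial>C) \<partial>\<mu>)"
      using integral_fst'[of f] int by (simp add: P_def)
    ultimately show ?thesis using f by (simp add: C(2))
  qed
  have YT: "Y (x, True) = S x" "Y (x, False) = T x" for x by (simp_all add: Y_def)
  have bl: "integrable P (\<lambda>z. (norm (R (Y z)))\<^sup>2) \<and> (\<integral>z. (norm (R (Y z)))\<^sup>2 \<partial>P)
      = ((\<integral>x. (norm (R (S x)))\<^sup>2 \<partial>\<mu>) + (\<integral>x. (norm (R (T x)))\<^sup>2 \<partial>\<mu>)) / 2"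
    if R: "bounded_linear R" for R :: "real^'n \<Rightarrow> 'b::euclidean_space"
  proof -
    have [measurable]: "R \<in> borel_measurable borel"
      using R by (auto intro!: borel_measurable_continuous_onI linear_continuous_on)
    show ?thesis
      using avg[of "\<lambda>z. (norm (R (Y z)))\<^sup>2"]
        integrable_norm_bounded_linear_P2[OF \<mu> bounded_linear_compose[OF R S]]
        integrable_norm_bounded_linear_P2[OF \<mu> bounded_linear_compose[OF R T]]
      by (simp add: YT add_divide_distrib)
  qed
  show ?thesis
  proof (rule that[of \<nu> \<pi>])
    have "integrable P (\<lambda>z. (norm (Y z))\<^sup>2)" using bl[OF bounded_linear_ident] by simp
    moreover have "(\<integral>z. Y z \<partial>P) = 0"
    proof -
      have "(\<integral>x. S x \<partial>\<mu>) = 0" "(\<integral>x. T x \<partial>\<mu>) = 0"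
        using integral_bounded_linear[OF S integrable_id_P2[OF \<mu>]]
          integral_bounded_linear[OF T integrable_id_P2[OF \<mu>]] \<mu> S T
        by (simp_all add: centered_P2_def linear_simps(3))
      moreover have "integrable \<mu> S" "integrable \<mu> T"
        using integrable_bounded_linear[OF S integrable_id_P2[OF \<mu>]]
          integrable_bounded_linear[OF T integrable_id_P2[OF \<mu>]] by simp_all
      ultimately show ?thesis using avg[OF Y] by (simp add: YT)
    qed
    ultimately show "\<nu> \<in> centered_P2"
      using prob_space.prob_space_distr[OF P Y]
      by (simp add: centered_P2_def \<nu>_def integrable_distr_eq[OF Y] integral_distr[OF Y])
    have "distr \<pi> borel fst = distr P borel fst"
      unfolding \<pi>_def by (subst distr_distr[OF _ \<phi>])
        (auto simp: \<phi>_def o_def intro!: borel_measurable_continuous_onI continuous_intros)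
    also have "\<dots> = \<mu>"
      using C.distr_pair_fst[of \<mu>] \<mu> unfolding P_def by (metis (no_types, lifting) \<open>sets \<mu> = sets borel\<close> distr_cong)
    finally have "distr \<pi> borel fst = \<mu>" .
    moreover have "distr \<pi> borel snd = \<nu>"
      unfolding \<pi>_def \<nu>_def by (subst distr_distr[OF _ \<phi>])
        (auto simp: \<phi>_def o_def intro!: borel_measurable_continuous_onI continuous_intros)
    ultimately show "\<pi> \<in> couplings \<mu> \<nu>"
      using prob_space.prob_space_distr[OF P \<phi>] by (simp add: couplings_def \<pi>_def)
    show "(\<integral>y. (w \<bullet> y)\<^sup>2 \<partial>\<nu>) = ((\<integral>x. (w \<bullet> S x)\<^sup>2 \<partial>\<mu>) + (\<integral>x. (w \<bullet> T x)\<^sup>2 \<partial>\<mu>)) / 2" for w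
      using bl[OF bounded_linear_inner_right[of w]] unfolding \<nu>_def by (simp add: integral_distr[OF Y])
    have "(\<integral>(x, y). (norm (x - y))\<^sup>2 \<partial>\<pi>) = (\<integral>z. (norm (fst z - Y z))\<^sup>2 \<partial>P)"
      unfolding \<pi>_def case_prod_beta
      by (subst integral_distr[OF \<phi>]) (auto simp: \<phi>_def intro!: borel_measurable_continuous_onI continuous_intros)
    also have "\<dots> = ((\<integral>x. (norm (x - S x))\<^sup>2 \<partial>\<mu>) + (\<integral>x. (norm (x - T x))\<^sup>2 \<partial>\<mu>)) / 2"
      using avg[of "\<lambda>z. (norm (fst z - Y z))\<^sup>2"]
        integrable_norm_bounded_linear_P2[OF \<mu> bounded_linear_sub[OF bounded_linear_ident S]]
        integrable_norm_bounded_linear_P2[OF \<mu> bounded_linear_sub[OF bounded_linear_ident T]]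
      by (simp add: YT add_divide_distrib)
    finally show "(\<integral>(x, y). (norm (x - y))\<^sup>2 \<partial>\<pi>)
      = ((\<integral>x. (norm (x - S x))\<^sup>2 \<partial>\<mu>) + (\<integral>x. (norm (x - T x))\<^sup>2 \<partial>\<mu>)) / 2" .
  qed
qed

text \<open>The target deviation \<open>r = (\<surd>\<lambda>\<^sub>1 + \<surd>\<lambda>\<^sub>2) / 2\<close> in both directions \<open>e\<^sub>1, e\<^sub>2\<close> is reached by rescaling
  the two coordinates. If \<open>\<lambda>\<^sub>2 = 0\<close> there is nothing to rescale along \<open>e\<^sub>2\<close>, and an independent random
  sign times a multiple of the first coordinate is added there instead.\<close>

lemma rescaling_coefficients:
  fixes l1 l2 :: real
  assumes "0 \<le> l2" "l2 \<le> l1"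
  defines "r \<equiv> (sqrt l1 + sqrt l2) / 2"
  obtains \<alpha> \<beta> \<gamma> where "(1 + \<alpha>)\<^sup>2 * l1 = r\<^sup>2" "(1 + \<beta>)\<^sup>2 * l2 + \<gamma>\<^sup>2 * l1 = r\<^sup>2"
    "\<alpha>\<^sup>2 * l1 + \<beta>\<^sup>2 * l2 + \<gamma>\<^sup>2 * l1 = (sqrt l1 - sqrt l2)\<^sup>2 / 2"
proof -
  define s t where "s = sqrt l1" and "t = sqrt l2"
  have st: "l1 = s\<^sup>2" "l2 = t\<^sup>2" "0 \<le> t" "t \<le> s" "\<bar>s\<bar> = s" "\<bar>t\<bar> = t"
    using assms by (auto simp: s_def t_def)
  have r: "r = (s + t) / 2" by (simp add: r_def s_def t_def)
  have scale: "(1 + (r / x - 1))\<^sup>2 * x\<^sup>2 = r\<^sup>2" "(r / x - 1)\<^sup>2 * x\<^sup>2 = (r - x)\<^sup>2" if "x \<noteq> 0" for x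
  proof -
    have "(1 + (r / x - 1)) * x = r" "(r / x - 1) * x = r - x"
      using that by (simp_all add: left_diff_distrib)
    then show "(1 + (r / x - 1))\<^sup>2 * x\<^sup>2 = r\<^sup>2" "(r / x - 1)\<^sup>2 * x\<^sup>2 = (r - x)\<^sup>2"
      by (metis power_mult_distrib)+
  qed
  \<comment> \<open>As \<open>r\<close> is the midpoint, each deviation moves by
    \<open>(s - t) / 2\<close>. For \<open>t = 0\<close> the added component has second moment
    \<open>r^2 = (r - t)^2\<close>, so the total is the same.\<close>
  have sum: "(r - s)\<^sup>2 + (r - t)\<^sup>2 = (s - t)\<^sup>2 / 2"
    by (simp add: r power2_eq_square field_simps)
  consider "s = 0" | "s \<noteq> 0" "t = 0" | "s \<noteq> 0" "t \<noteq> 0" by blast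
  then show ?thesis
  proof cases
    case 1
    then have "t = 0" using st by simp
    then show ?thesis using 1 that[of 0 0 0] st by (simp add: r s_def[symmetric] t_def[symmetric])
  next
    case 2
    then show ?thesis
      using that[of "r / s - 1" 0 "r / s"] scale[of s] sum
      by (simp add: st s_def[symmetric] t_def[symmetric] power_divide)
  next
    case 3
    then show ?thesis
      using that[of "r / s - 1" "r / t - 1" 0] scale[of s] scale[of t] sum
      by (simp add: st s_def[symmetric] t_def[symmetric])
  qed
qed

lemma W2_unstable_attained:
  fixes \<mu> :: "(real^'n) measure"
  assumes n: "CARD('n) \<ge> 2" and \<mu>: "\<mu> \<in> centered_P2"
  obtains \<nu> where "\<nu> \<in> pca_unstable"
    "W2 \<mu> \<nu> \<le> (sqrt (ordered_eigenvalue 1 (second_moment \<mu>)) - sqrt (ordered_eigenvalue 2 (second_moment \<mu>))) / sqrt 2"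
proof -
  define A where "A = second_moment \<mu>"
  define l1 where "l1 = ordered_eigenvalue 1 A"
  define l2 where "l2 = ordered_eigenvalue 2 A"
  obtain e1 e2 where e: "norm e1 = 1" "norm e2 = 1" "e1 \<bullet> e2 = 0"
    "A *v e1 = l1 *\<^sub>R e1" "A *v e2 = l2 *\<^sub>R e2" "0 \<le> l2" "l2 \<le> l1" "top_eigenvalue ((*v) A) e1 l1 l2"
    unfolding A_def l1_def l2_def using second_moment_top_eigenpair[OF \<mu> n] .
  interpret T: top_eigenvalue "(*v) A" e1 l1 l2 by fact
  have ee: "e1 \<bullet> e1 = 1" "e2 \<bullet> e2 = 1" "e2 \<bullet> e1 = 0" "e1 \<bullet> e2 = 0"
    using e by (simp_all add: norm_eq_1 inner_commute)
  define r where "r = (sqrt l1 + sqrt l2) / 2"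
  obtain \<alpha> \<beta> \<gamma> where coeff: "(1 + \<alpha>)\<^sup>2 * l1 = r\<^sup>2" "(1 + \<beta>)\<^sup>2 * l2 + \<gamma>\<^sup>2 * l1 = r\<^sup>2"
    "\<alpha>\<^sup>2 * l1 + \<beta>\<^sup>2 * l2 + \<gamma>\<^sup>2 * l1 = (sqrt l1 - sqrt l2)\<^sup>2 / 2"
    unfolding r_def using rescaling_coefficients[OF e(6,7)] .
  \<comment> \<open>Mixing \<open>R \<gamma>\<close> and \<open>R (-\<gamma>)\<close> adds
    \<open>\<gamma> * (e1 \<bullet> x)\<close> with a random sign along \<open>e2\<close>;
    directions orthogonal to \<open>e1\<close> and \<open>e2\<close> are left alone.\<close>
  define R where "R c x = x + (\<alpha> * (e1 \<bullet> x)) *\<^sub>R e1 + (\<beta> * (e2 \<bullet> x) + c * (e1 \<bullet> x)) *\<^sub>R e2" for c and x :: "real^'n"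
  have R: "bounded_linear (R c)" for c
    unfolding R_def linear_conv_bounded_linear[symmetric]
    by (intro linearI) (auto simp: inner_simps algebra_simps)
  obtain \<nu> \<pi> where \<nu>: "\<nu> \<in> centered_P2" "\<pi> \<in> couplings \<mu> \<nu>"
    and var: "\<And>w. (\<integral>y. (w \<bullet> y)\<^sup>2 \<partial>\<nu>) = ((\<integral>x. (w \<bullet> R \<gamma> x)\<^sup>2 \<partial>\<mu>) + (\<integral>x. (w \<bullet> R (-\<gamma>) x)\<^sup>2 \<partial>\<mu>)) / 2"
    and cost: "(\<integral>(x, y). (norm (x - y))\<^sup>2 \<partial>\<pi>) = ((\<integral>x. (norm (x - R \<gamma> x))\<^sup>2 \<partial>\<mu>) + (\<integral>x. (norm (x - R (-\<gamma>) x))\<^sup>2 \<partial>\<mu>)) / 2"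
    using coin_mixture_coupling[OF \<mu> R[of \<gamma>] R[of "-\<gamma>"]] by blast
  note sq = integral_inner_square[OF \<mu>, folded A_def]
  note mult = integral_inner_mult[OF \<mu>, folded A_def]
  \<comment> \<open>The mixed term integrates to 0, since \<open>e1\<close> and \<open>e2\<close>
    are orthogonal eigenvectors, so both signs of \<open>c\<close> cost the same.\<close>
  have disp: "(\<integral>x. (norm (x - R c x))\<^sup>2 \<partial>\<mu>) = \<alpha>\<^sup>2 * l1 + \<beta>\<^sup>2 * l2 + c\<^sup>2 * l1" for c
  proof -
    have "(norm (x - R c x))\<^sup>2 = \<alpha>\<^sup>2 * (e1 \<bullet> x)\<^sup>2 + \<beta>\<^sup>2 * (e2 \<bullet> x)\<^sup>2 + (2 * \<beta> * c) * ((e1 \<bullet> x) * (e2 \<bullet> x)) + c\<^sup>2 * (e1 \<bullet> x)\<^sup>2" for x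
    proof -
      have "x - R c x = - ((\<alpha> * (e1 \<bullet> x)) *\<^sub>R e1 + (\<beta> * (e2 \<bullet> x) + c * (e1 \<bullet> x)) *\<^sub>R e2)"
        by (simp add: R_def)
      then have "(norm (x - R c x))\<^sup>2 =
          (norm ((\<alpha> * (e1 \<bullet> x)) *\<^sub>R e1 + (\<beta> * (e2 \<bullet> x) + c * (e1 \<bullet> x)) *\<^sub>R e2))\<^sup>2"
        by (simp only: norm_minus_cancel)
      also have "\<dots> = (\<alpha> * (e1 \<bullet> x))\<^sup>2 + (\<beta> * (e2 \<bullet> x) + c * (e1 \<bullet> x))\<^sup>2"
        unfolding power2_norm_eq_inner using ee by (simp add: inner_simps power2_eq_square)
      finally show ?thesis by (simp add: power2_eq_square algebra_simps)
    qed
    then show ?thesis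
      using integrable_inner_square_P2[OF \<mu>] integrable_inner_mult_P2[OF \<mu>] e ee
      by (simp add: sq mult)
  qed
  have var': "(\<integral>y. (w \<bullet> y)\<^sup>2 \<partial>\<nu>) = r\<^sup>2 * (e1 \<bullet> w)\<^sup>2 + r\<^sup>2 * (e2 \<bullet> w)\<^sup>2 + w' \<bullet> (A *v w')"
    if w': "w' = w - (e1 \<bullet> w) *\<^sub>R e1 - (e2 \<bullet> w) *\<^sub>R e2" for w w'
  proof -
    define a b where "a = e1 \<bullet> w" and "b = e2 \<bullet> w"
    have w: "w = a *\<^sub>R e1 + b *\<^sub>R e2 + w'" by (simp add: w' a_def b_def)
    have o: "w' \<bullet> e1 = 0" "w' \<bullet> e2 = 0" "e1 \<bullet> w' = 0" "e2 \<bullet> w' = 0"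
      using ee by (simp_all add: w' inner_simps inner_commute)
    have oA: "e1 \<bullet> (A *v w') = 0" "e2 \<bullet> (A *v w') = 0"
      using T.sym[of e1 w'] T.sym[of e2 w'] e o by simp_all
    have part: "(\<integral>x. (w \<bullet> R c x)\<^sup>2 \<partial>\<mu>) =
        ((1 + \<alpha>) * a + c * b)\<^sup>2 * l1 + ((1 + \<beta>) * b)\<^sup>2 * l2 + w' \<bullet> (A *v w')" for c
    proof -
      define p where "p = ((1 + \<alpha>) * a + c * b) *\<^sub>R e1 + ((1 + \<beta>) * b) *\<^sub>R e2 + w'"
      have "w \<bullet> R c x = p \<bullet> x" for x
        using ee o unfolding R_def p_def w by (simp add: inner_simps algebra_simps)
      then have "(\<integral>x. (w \<bullet> R c x)\<^sup>2 \<partial>\<mu>) = p \<bullet> (A *v p)" by (simp add: sq)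
      also have "A *v p = (((1 + \<alpha>) * a + c * b) * l1) *\<^sub>R e1 + (((1 + \<beta>) * b) * l2) *\<^sub>R e2 + A *v w'"
        unfolding p_def using e by (simp add: linear_add[OF T.lin] linear_scale[OF T.lin])
      also have "p \<bullet> \<dots> = ((1 + \<alpha>) * a + c * b)\<^sup>2 * l1 + ((1 + \<beta>) * b)\<^sup>2 * l2 + w' \<bullet> (A *v w')"
        unfolding p_def using ee o oA by (simp add: inner_simps power2_eq_square)
      finally show ?thesis .
    qed
    \<comment> \<open>The square in \<open>part\<close> contains
      \<open>2 * (1 + \<alpha>) * c * a * b\<close>, which cancels between
      \<open>c = \<gamma>\<close> and \<open>c = - \<gamma>\<close>.\<close>
    have "(\<integral>y. (w \<bullet> y)\<^sup>2 \<partial>\<nu>) =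
        ((1 + \<alpha>)\<^sup>2 * l1) * a\<^sup>2 + ((1 + \<beta>)\<^sup>2 * l2 + \<gamma>\<^sup>2 * l1) * b\<^sup>2 + w' \<bullet> (A *v w')"
      unfolding var part by (simp add: power2_eq_square field_simps)
    then show ?thesis unfolding coeff a_def b_def .
  qed
  have obj: "pca_objective \<nu> w = (\<integral>y. (w \<bullet> y)\<^sup>2 \<partial>\<nu>) / 2" for w
    unfolding pca_objective_def by simp
  \<comment> \<open>The untouched directions have second moment at most \<open>l2\<close>, so they
    do not exceed the value \<open>r^2\<close> now taken on the plane of \<open>e1\<close> and
    \<open>e2\<close>.\<close>
  have "sqrt l2 \<le> r" using e by (simp add: r_def)
  then have l2r: "l2 \<le> r\<^sup>2" using e power_mono[of "sqrt l2" r 2] by simp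
  have "\<nu> \<in> pca_unstable"
  \<comment> \<open>Instability is read off from the objective of \<open>\<nu>\<close>; its
    eigenvalues are never computed.\<close>
  proof (rule pca_unstable_of_double_top[OF \<nu>(1) e(1-3), of "r\<^sup>2 / 2"])
    show "pca_objective \<nu> w \<le> r\<^sup>2 / 2" if w: "norm w = 1" for w
    proof -
      define w' where "w' = w - (e1 \<bullet> w) *\<^sub>R e1 - (e2 \<bullet> w) *\<^sub>R e2"
      have "e1 \<bullet> w' = 0" using ee by (simp add: w'_def inner_simps)
      from T.le[OF this] have "w' \<bullet> (A *v w') \<le> l2 * (norm w')\<^sup>2" .
      also have "\<dots> \<le> r\<^sup>2 * (norm w')\<^sup>2" using l2r by (intro mult_right_mono) auto
      also have "(norm w')\<^sup>2 = 1 - (e1 \<bullet> w)\<^sup>2 - (e2 \<bullet> w)\<^sup>2"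
        using ee w unfolding power2_norm_eq_inner w'_def norm_eq_1
        by (simp add: inner_simps inner_commute power2_eq_square)
      finally show ?thesis unfolding obj var'[OF w'_def] by (simp add: algebra_simps)
    qed
    show "pca_objective \<nu> (a *\<^sub>R e1 + b *\<^sub>R e2) = r\<^sup>2 / 2" if "a\<^sup>2 + b\<^sup>2 = 1" for a b
    proof -
      have "(\<integral>y. ((a *\<^sub>R e1 + b *\<^sub>R e2) \<bullet> y)\<^sup>2 \<partial>\<nu>) = r\<^sup>2 * (a\<^sup>2 + b\<^sup>2)"
        using ee by (subst var'[of 0]) (simp_all add: inner_simps algebra_simps)
      then show ?thesis using that by (simp add: obj)
    qed
  qed
  moreover have "W2 \<mu> \<nu> \<le> (sqrt l1 - sqrt l2) / sqrt 2"
  proof -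
    have total: "(\<integral>(x, y). (norm (x - y))\<^sup>2 \<partial>\<pi>) = (sqrt l1 - sqrt l2)\<^sup>2 / 2"
      unfolding cost disp power2_minus coeff(3) by simp
    then show ?thesis
      using W2_le[OF \<nu>(2)] e unfolding total by (simp add: real_sqrt_divide)
  qed
  ultimately show ?thesis using that by (simp add: l1_def l2_def A_def)
qed

theorem theorem3p2:
  fixes D :: "(real^'d) measure"
  assumes "CARD('d) \<ge> 2"
    and "D \<in> centered_P2"
  shows "pca_RSE D = ereal (1 / sqrt 2 *
           (sqrt (ordered_eigenvalue 1 (second_moment D)) - sqrt (ordered_eigenvalue 2 (second_moment D))))
    \<and> (D \<notin> pca_unstable \<longrightarrow>
        (\<forall>v\<in>pca_maximizers D. pca_RSE D * pca_REG D v = ereal (1 / (sqrt 2 *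
           (sqrt (ordered_eigenvalue 1 (second_moment D)) + sqrt (ordered_eigenvalue 2 (second_moment D)))))))"
proof -
  define l1 where "l1 = ordered_eigenvalue 1 (second_moment D)"
  define l2 where "l2 = ordered_eigenvalue 2 (second_moment D)"
  have l: "0 \<le> l2" "l2 \<le> l1"
    unfolding l1_def l2_def using second_moment_top_eigenpair[OF assms(2,1)] by blast+
  obtain \<nu> where \<nu>: "\<nu> \<in> pca_unstable" "W2 D \<nu> \<le> (sqrt l1 - sqrt l2) / sqrt 2"
    unfolding l1_def l2_def using W2_unstable_attained[OF assms] .
  have "pca_RSE D \<le> ereal ((sqrt l1 - sqrt l2) / sqrt 2)"
    unfolding pca_RSE_def W2_set_def using \<nu> by (intro INF_lower2[of \<nu>]) auto
  moreover have "ereal ((sqrt l1 - sqrt l2) / sqrt 2) \<le> pca_RSE D"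
    unfolding pca_RSE_def W2_set_def l1_def l2_def
    by (intro INF_greatest) (simp only: ereal_less_eq W2_unstable_lower_bound[OF assms])
  ultimately have RSE: "pca_RSE D = ereal (1 / sqrt 2 * (sqrt l1 - sqrt l2))" by (simp add: antisym)
  moreover have "pca_RSE D * pca_REG D v = ereal (1 / (sqrt 2 * (sqrt l1 + sqrt l2)))"
    if D: "D \<notin> pca_unstable" and v: "v \<in> pca_maximizers D" for v
  proof -
    have gap: "l2 < l1"
      using D l pca_unstable_iff[OF assms(2,1)] by (auto simp: l1_def l2_def)
    then have "sqrt l2 < sqrt l1" by simp
    moreover have "l1 - l2 = (sqrt l1 - sqrt l2) * (sqrt l1 + sqrt l2)"
      using l by (simp add: algebra_simps)
    ultimately have "1 / sqrt 2 * (sqrt l1 - sqrt l2) * (1 / (l1 - l2)) = 1 / (sqrt 2 * (sqrt l1 + sqrt l2))"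
      by simp
    then show ?thesis
      using pca_regular_of_gap(2)[OF assms(2,1) _ v] gap
      unfolding RSE l1_def[symmetric] l2_def[symmetric] by simp
  qed
  ultimately show ?thesis unfolding l1_def l2_def by blast
qed

end
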